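(* Let $T>0$, let $K$ be a radial potential on $\mathbb{R}^d$ with $\nabla K\in W^{1,\infty}(\mathbb{R}^d)$, and let $f_0\in\mathcal{P}_1(\mathbb{R}^d\times\mathbb{R}^d)$ have compact support, with first marginal $\rho_0$. For $\epsilon>0$ let $f_\epsilon$ be the measure-valued solution of $$\partial_t f_\epsilon+v\cdot\nabla_x f_\epsilon=\frac1\epsilon\nabla_v\cdot\big((v+\nabla_xK\ast\rho_\epsilon)f_\epsilon\big),\qquad f_\epsilon|_{t=0}=f_0,$$ with first marginal $\rho_\epsilon$, and let $\rho\in C([0,T);\mathcal{P}_1(\mathbb{R}^d))$ be the limiting macroscopic density, $\rho_\epsilon(t,\cdot)\to\rho(t,\cdot)$ in $W_1$ as $\epsilon\to0$ for each $t\in[0,T)$. Let $\mathcal{T}^t$ be the limiting flow map $\mathcal{T}^t(x_0)=x(t;x_0)$, where $x(\cdot\,;x_0)$ solves $\frac{dx}{dt}=-\nabla_xK\ast\rho(t,x)$, $x(0)=x_0$. Then $\rho$ is the push-forward of the initial density $\rho_0$ by $\mathcal{T}^t$: $$\rho(t)=\mathcal{T}^t\#\rho_0,\qquad t\in[0,T).$$ In addition, for each $t\in[0,T)$, $f_\epsilon(t,\cdot,\cdot)$ converges in the $W_1$ metric to a probability density (measure) $f(t,\cdot,\cdot)\in\mathcal{P}_1(\mathbb{R}^d\times\mathbb{R}^d)$: $$f_\epsilon(t,\cdot,\cdot)\to f(t,\cdot,\cdot)\quad\text{in }\mathcal{P}_1(\mathbb{R}^d\times\mathbb{R}^d)\text{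 as }\epsilon\to0.$$ The limiting density $f$, with first marginal $\rho$, is given explicitly by $$f(t,x,v)=\rho(t,x)\,\delta\big(v+\nabla K\ast\rho(t,x)\big).$$
   Context: Convention: $\int\varphi(x)\mu(x)\,dx$ denotes the integral of $\varphi$ against the measure $\mu$, whether or not $\mu$ is absolutely continuous. $\mathcal{P}_1(\mathbb{R}^k)$ is the set of probability measures on $\mathbb{R}^k$ with finite first moment, endowed with the $1$-Wasserstein distance $W_1$. The first marginal $\rho$ of $f$ is defined by $\int_{\mathbb{R}^d}\tilde\psi(x)\rho(t,x)\,dx=\iint\tilde\psi(x)f(t,x,v)\,dx\,dv$ for all $\tilde\psi\in C_b(\mathbb{R}^d)$. "Radial" means that $K(x)$ depends only on $|x|$. The formula $f(t,x,v)=\rho(t,x)\delta(v+\nabla K\ast\rho(t,x))$ means $\iint\zeta(x,v)f(t,x,v)\,dx\,dv=\int\zeta(x,-\nabla K\ast\rho(t,x))\rho(t,x)\,dx$ for all $\zeta\in C_b(\mathbb{R}^d\times\mathbb{R}^d)$. Measure-valued solution of the kinetic equation (for fixed $\epsilon>0$): for a continuous vector field $E(t,x)$ on $[0,T]\times\mathbb{R}^d$, locally Lipschitz in $x$ and with $|E(t,x)|\le C(1+|x|)$ for some $C>0$, let $\mathcal{T}^{t,\epsilon}_E:(x_0,v_0)\mapsto(x(t),v(t))$ be the flow map of $\frac{dx}{dt}=v$, $\frac{dv}{dt}=-\frac1\epsilon v+\frac1\epsilon E(t,x)$, $(x,v)(0)=(x_0,v_0)$. For $f:[0,T]\to\mathcal{P}_1(\mathbb{R}^d\times\mathbb{R}^d)$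 with first marginal $\rho$ put $E[f]=-\nabla K\ast\rho$. Then $f$ is a solution with initial condition $f_0$ if $E[f]$ is locally Lipschitz in $x$ and satisfies $|E[f](t,x)|\le C(1+|x|)$ on $[0,T]\times\mathbb{R}^d$ for some $C>0$, and $f(t)=\mathcal{T}^{t,\epsilon}_{E[f]}\#f_0$ (push-forward) for all $t$. It is known (Cañizo–Carrillo–Rosado) that for compactly supported $f_0\in\mathcal{P}_1(\mathbb{R}^d\times\mathbb{R}^d)$ there is a unique solution $f_\epsilon\in C([0,\infty);\mathcal{P}_1(\mathbb{R}^d\times\mathbb{R}^d))$ in this sense whose support is contained, for $t\in[0,T]$, in a ball $B_{R_\epsilon(T)}$ with $R_\epsilon$ increasing; $f_\epsilon$ is this solution. Limiting density: for every $t\in[0,T)$ the $W_1$-limit $\rho(t,\cdot)=\lim_{\epsilon\to0}\rho_\epsilon(t,\cdot)$ exists in $\mathcal{P}_1(\mathbb{R}^d)$, and $\rho$ is the unique weak solution (tested against all $\psi\in C^1_c([0,T);C^1_b(\mathbb{R}^d))$, among narrowly continuous curves of probability measures) of $\rho_t-\nabla_x\cdot((\nabla_xK\ast\rho)\rho)=0$, $\rho|_{t=0}=\rho_0$.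
   Formalization: The explicit formula f = ρ δ(v + ∇K∗ρ) is asserted only for 0 < t < T, because at t = 0 the limit is f_0 itself, which is arbitrary (e.g. K = 0, f_0 = δ_(0,v0) with v0 ≠ 0); all other claims include t = 0. *)

theory Defs
  imports "HOL-Probability.Probability"
begin

section \<open>The space $W^{1,\infty}$ and weak gradients\<close>

primrec Ck :: "nat \<Rightarrow> ('a::euclidean_space \<Rightarrow> real) \<Rightarrow> bool" where
  "Ck 0 = (\<lambda>f. continuous_on UNIV f)"
| "Ck (Suc k) = (\<lambda>f. (\<forall>x. f differentiable (at x)) \<and>
      (\<forall>i\<in>Basis. Ck k (\<lambda>x. frechet_derivative f (at x) i)))"

definition test_function :: "('a::euclidean_space \<Rightarrow> real) \<Rightarrow> bool" where
  "test_function \<phi> \<longleftrightarrow> (\<forall>k. Ck k \<phi>) \<and> compact (closure {x. \<phi> x \<noteq> 0})"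

definition locally_integrable :: "('a::euclidean_space \<Rightarrow> real) \<Rightarrow> bool" where
  "locally_integrable g \<longleftrightarrow> (\<forall>S. compact S \<longrightarrow> set_integrable lebesgue S g)"

definition weak_partial ::
    "'a::euclidean_space \<Rightarrow> ('a \<Rightarrow> real) \<Rightarrow> ('a \<Rightarrow> real) \<Rightarrow> bool" where
  "weak_partial i g h \<longleftrightarrow> locally_integrable g \<and> locally_integrable h \<and>
     (\<forall>\<phi>. test_function \<phi> \<longrightarrow>
        (LINT x|lebesgue. g x * frechet_derivative \<phi> (at x) i) = - (LINT x|lebesgue. h x * \<phi> x))"

definition weak_gradient :: "('a::euclidean_space \<Rightarrow> real) \<Rightarrow> ('a \<Rightarrow> 'a) \<Rightarrow> bool" where
  "weak_gradient g G \<longleftrightarrow> (\<forall>i\<in>Basis. weak_partial i g (\<lambda>x. G x \<bullet> i))"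

definition L_infty :: "('a::euclidean_space \<Rightarrow> real) set" where
  "L_infty = {g. g \<in> borel_measurable lebesgue \<and> (\<exists>C. AE x in lebesgue. \<bar>g x\<bar> \<le> C)}"

definition W1_infty :: "('a::euclidean_space \<Rightarrow> real) set" where
  "W1_infty = {g. g \<in> L_infty \<and> (\<forall>i\<in>Basis. \<exists>h\<in>L_infty. weak_partial i g h)}"

definition W1_infty_field :: "('a::euclidean_space \<Rightarrow> 'a) set" where
  "W1_infty_field = {G. \<forall>j\<in>Basis. (\<lambda>x. G x \<bullet> j) \<in> W1_infty}"

definition radial :: "('a::real_normed_vector \<Rightarrow> real) \<Rightarrow> bool" where
  "radial K \<longleftrightarrow> (\<forall>x y. norm x = norm y \<longrightarrow> K x = K y)"

text \<open>
  A field in $W^{1,\infty}$ is only determined almost everywhere, whereas its convolution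
  with a measure needs point values. As usual these are the values of the (unique)
  continuous representative, so the gradient of \<open>K\<close> is a continuous field \<open>gK\<close>.\<close>

definition potential_gradient :: "('a::euclidean_space \<Rightarrow> real) \<Rightarrow> ('a \<Rightarrow> 'a) \<Rightarrow> bool" where
  "potential_gradient K gK \<longleftrightarrow> weak_gradient K gK \<and> gK \<in> W1_infty_field \<and> continuous_on UNIV gK"


section \<open>Probability measures with finite first moment\<close>

definition P1 :: "'a::euclidean_space measure set" where
  "P1 = {\<mu>. prob_space \<mu> \<and> sets \<mu> = sets borel \<and> integrable \<mu> norm}"

definition couplings :: "'a::euclidean_space measure \<Rightarrow> 'a measure \<Rightarrow> ('a \<times> 'a) measure set" where
  "couplings \<mu> \<nu> = {\<pi>. prob_space \<pi> \<and> sets \<pi> = sets borel \<and>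
      distr \<pi> borel fst = \<mu> \<and> distr \<pi> borel snd = \<nu>}"

definition W1 :: "'a::euclidean_space measure \<Rightarrow> 'a measure \<Rightarrow> ennreal" where
  "W1 \<mu> \<nu> = (INF \<pi>\<in>couplings \<mu> \<nu>. \<integral>\<^sup>+ z. ennreal (dist (fst z) (snd z)) \<partial>\<pi>)"

definition P1_curve :: "real set \<Rightarrow> (real \<Rightarrow> 'a::euclidean_space measure) \<Rightarrow> bool" where
  "P1_curve I \<mu> \<longleftrightarrow> (\<forall>t\<in>I. \<mu> t \<in> P1) \<and>
      (\<forall>t\<in>I. ((\<lambda>s. W1 (\<mu> s) (\<mu> t)) \<longlongrightarrow> 0) (at t within I))"

definition msupport :: "'a::euclidean_space measure \<Rightarrow> 'a set" where
  "msupport \<mu> = {x. \<forall>U. open U \<longrightarrow> x \<in> U \<longrightarrow> emeasure \<mu> U > 0}"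

definition first_marginal :: "('a::euclidean_space \<times> 'a) measure \<Rightarrow> 'a measure" where
  "first_marginal f = distr f borel fst"


section \<open>Flows and the kinetic equation\<close>

definition convol :: "('a::euclidean_space \<Rightarrow> 'a) \<Rightarrow> 'a measure \<Rightarrow> 'a \<Rightarrow> 'a" where
  "convol G \<mu> x = (LINT y|\<mu>. G (x - y))"

text \<open>\<open>\<Phi> t z\<close> is the value at time \<open>t\<close> of the trajectory of \<open>b\<close> starting at \<open>z\<close> at time \<open>0 \<in> I\<close>;
  at end points of \<open>I\<close> the derivative is one-sided.\<close>

definition is_flow ::
    "real set \<Rightarrow> (real \<Rightarrow> 'b::real_normed_vector \<Rightarrow> 'b) \<Rightarrow> (real \<Rightarrow> 'b \<Rightarrow> 'b) \<Rightarrow> bool" where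
  "is_flow I b \<Phi> \<longleftrightarrow> (\<forall>z. \<Phi> 0 z = z \<and>
      (\<forall>t\<in>I. ((\<lambda>s. \<Phi> s z) has_vector_derivative b t (\<Phi> t z)) (at t within I)))"

definition kinetic_field ::
    "real \<Rightarrow> (real \<Rightarrow> 'a::euclidean_space \<Rightarrow> 'a) \<Rightarrow> real \<Rightarrow> 'a \<times> 'a \<Rightarrow> 'a \<times> 'a" where
  "kinetic_field \<epsilon> E t = (\<lambda>(x, v). (v, - (1 / \<epsilon>) *\<^sub>R v + (1 / \<epsilon>) *\<^sub>R E t x))"

definition admissible_field :: "real \<Rightarrow> (real \<Rightarrow> 'a::euclidean_space \<Rightarrow> 'a) \<Rightarrow> bool" where
  "admissible_field T E \<longleftrightarrow>
     continuous_on ({0..T} \<times> UNIV) (\<lambda>(t, x). E t x) \<and>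
     local_lipschitz {0..T} UNIV E \<and>
     (\<exists>C>0. \<forall>t\<in>{0..T}. \<forall>x. norm (E t x) \<le> C * (1 + norm x))"

definition force ::
    "('a::euclidean_space \<Rightarrow> 'a) \<Rightarrow> (real \<Rightarrow> 'a measure) \<Rightarrow> real \<Rightarrow> 'a \<Rightarrow> 'a" where
  "force gK \<rho> t x = - convol gK (\<rho> t) x"

text \<open>For an admissible field the flow on \<open>{0..T}\<close> exists and is unique, so that the existential
  quantifier over \<open>\<Phi>\<close> below just names the flow map.\<close>

definition kinetic_solution_on ::
    "real \<Rightarrow> ('a::euclidean_space \<Rightarrow> 'a) \<Rightarrow> real \<Rightarrow> ('a \<times> 'a) measure \<Rightarrow>
     (real \<Rightarrow> ('a \<times> 'a) measure) \<Rightarrow> bool" where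
  "kinetic_solution_on T gK \<epsilon> f0 f \<longleftrightarrow>
     (\<forall>t\<in>{0..T}. f t \<in> P1) \<and>
     admissible_field T (force gK (\<lambda>t. first_marginal (f t))) \<and>
     (\<exists>\<Phi>. is_flow {0..T} (kinetic_field \<epsilon> (force gK (\<lambda>t. first_marginal (f t)))) \<Phi> \<and>
        (\<forall>t\<in>{0..T}. f t = distr f0 borel (\<Phi> t)))"

definition kinetic_solution ::
    "('a::euclidean_space \<Rightarrow> 'a) \<Rightarrow> real \<Rightarrow> ('a \<times> 'a) measure \<Rightarrow>
     (real \<Rightarrow> ('a \<times> 'a) measure) \<Rightarrow> bool" where
  "kinetic_solution gK \<epsilon> f0 f \<longleftrightarrow>
     P1_curve {0..} f \<and> (\<forall>T>0. kinetic_solution_on T gK \<epsilon> f0 f)"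

text \<open>\<open>monokinetic \<rho> u f\<close> says $f(x,v) = \rho(x)\,\delta(v - u(x))$. The limit of
  \<open>f\<^sub>\<epsilon>(t)\<close> has this form only for \<open>t > 0\<close>: at \<open>t = 0\<close> it is the initial measure \<open>f\<^sub>0\<close>, which is
  arbitrary (initial layer in the velocity).\<close>

definition monokinetic ::
    "'a::euclidean_space measure \<Rightarrow> ('a \<Rightarrow> 'a) \<Rightarrow> ('a \<times> 'a) measure \<Rightarrow> bool" where
  "monokinetic \<rho> u f \<longleftrightarrow>
     (\<forall>\<zeta> :: 'a \<times> 'a \<Rightarrow> real. continuous_on UNIV \<zeta> \<longrightarrow> bounded (range \<zeta>) \<longrightarrow>
        (LINT z|f. \<zeta> z) = (LINT x|\<rho>. \<zeta> (x, u x)))"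

end

theory Submission
  imports Defs
begin

text \<open>
  Let \<open>E\<^sub>\<epsilon> = - gK * \<rho>\<^sub>\<epsilon>\<close> and \<open>E = - gK * \<rho>\<close>. A kinetic solution is the push-forward of \<open>f0\<close> by the
  trajectories of \<open>x' = v\<close>, \<open>\<epsilon> v' = E\<^sub>\<epsilon>(t, x) - v\<close>, so everything follows from the behaviour of a single
  trajectory as \<open>\<epsilon> \<rightarrow> 0\<close>, integrated against \<open>f0\<close>.

  A continuous field in \<open>W\<^sup>1\<^sup>,\<^sup>\<infinity>\<close> is bounded, by \<open>M\<close>, and Lipschitz, with constant \<open>L\<close>
  (\<open>potential_gradient_bounded_lipschitz\<close>, proved by mollification). All the fields \<open>E\<^sub>\<epsilon>(t, \<cdot>)\<close> and
  \<open>E(t, \<cdot>)\<close> inherit these two constants, and a \<open>W\<^sub>1\<close> limit of densities gives a pointwise limit of forces.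
  From the bound, \<open>\<bar>v\<bar> \<le> \<bar>v\<^sub>0\<bar> + M\<close> uniformly in \<open>\<epsilon>\<close> (\<open>velocity_bound\<close>).

  For the positions, the shifted point \<open>y = x + \<epsilon> v\<close> satisfies \<open>y' = E\<^sub>\<epsilon>(t, x)\<close>: the stiff term cancels.
  Since \<open>\<bar>x - y\<bar> = O(\<epsilon>)\<close>, Gronwall's inequality compares \<open>y\<close> with the solution \<open>X\<close> of \<open>X' = E(t, X)\<close>, with an
  error \<open>O(\<epsilon>)\<close> plus the integral of \<open>\<bar>E\<^sub>\<epsilon>(s, X(s)) - E(s, X(s))\<bar>\<close>, which vanishes by dominated
  convergence (\<open>position_error\<close>, \<open>position_tendsto\<close>).

  For the velocities, the force along a trajectory is Lipschitz in time uniformly in \<open>\<epsilon>\<close>, because the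
  positions that generate it move with bounded speed. Hence \<open>v\<close> relaxes to the force within
  \<open>O(exp (- t / \<epsilon>)) + O(\<epsilon>)\<close> (\<open>velocity_relaxation\<close>, \<open>velocity_tendsto\<close>). For \<open>t = 0\<close> there is
  no relaxation, and the limit is \<open>f0\<close> itself.

  So the trajectories converge pointwise, with linearly growing bounds, and the coupling of two
  push-forwards of \<open>f0\<close> through their common starting point turns this into convergence in \<open>W\<^sub>1\<close>
  (\<open>W1_distr_tendsto\<close>, \<open>small_inertia_limit\<close>). Comparing with the hypothesis on \<open>\<rho>\<^sub>\<epsilon>\<close> and using that \<open>W\<^sub>1\<close>
  limits are unique identifies \<open>\<rho>(t)\<close> as the push-forward of \<open>\<rho>\<^sub>0\<close> by \<open>X\<close>.
\<close>

section \<open>Smooth bump functions\<close>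

text \<open>
  The powers of \<open>1 / t\<close> make the linear span of the family closed under differentiation, so that the
  smoothness of \<open>exp (- 1 / t)\<close> at \<open>0\<close> needs only first derivatives.
\<close>

definition flat_exp :: "nat \<Rightarrow> real \<Rightarrow> real" where
  "flat_exp n t = (if t > 0 then exp (- (1 / t)) / t ^ n else 0)"

lemma flat_exp_nonneg: "0 \<le> flat_exp n t"
  by (simp add: flat_exp_def)

text \<open>
  At the right of \<open>0\<close> this is the decay of \<open>u ^ n / exp u\<close> for \<open>u = 1 / t \<rightarrow> \<infinity>\<close>.
\<close>

lemma tendsto_flat_exp_0: "(flat_exp n \<longlongrightarrow> 0) (at 0)"
proof -
  have "((\<lambda>t. inverse t ^ n / exp (inverse t)) \<longlongrightarrow> 0) (at_right (0::real))"
    by (rule filterlim_compose[OF tendsto_power_div_exp_0 filterlim_inverse_at_top_right])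
  then have "(flat_exp n \<longlongrightarrow> 0) (at_right 0)"
    by (rule Lim_transform_eventually)
      (auto simp: flat_exp_def eventually_at_right_field exp_minus field_simps intro!: exI[of _ 1])
  moreover have "(flat_exp n \<longlongrightarrow> 0) (at_left 0)"
    by (rule Lim_transform_eventually[OF tendsto_const])
      (auto simp: flat_exp_def eventually_at_left_field intro!: exI[of _ "-1"])
  ultimately show ?thesis
    by (simp add: filterlim_split_at)
qed

lemma DERIV_flat_exp:
  "(flat_exp n has_real_derivative flat_exp (n + 2) t - real n * flat_exp (n + 1) t) (at t)"
proof (rule linorder_cases[of t 0])
  assume t: "t < 0"
  have "((\<lambda>_. 0) has_real_derivative flat_exp (n + 2) t - real n * flat_exp (n + 1) t) (at t)"
    using t by (simp add: flat_exp_def)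
  then show ?thesis
    by (rule has_field_derivative_transform_within_open[of _ _ _ "{..<0}"])
      (use t in \<open>auto simp: flat_exp_def\<close>)
next
  assume t: "t = 0"
  have "((\<lambda>h. (flat_exp n (0 + h) - flat_exp n 0) / h) \<longlongrightarrow> 0) (at 0)"
    by (rule Lim_transform_eventually[OF tendsto_flat_exp_0[of "Suc n"]])
      (auto simp: flat_exp_def eventually_at_filter)
  then show ?thesis
    using t by (simp add: DERIV_def flat_exp_def)
next
  assume t: "0 < t"
  have "((\<lambda>t. exp (- (1 / t)) / t ^ n) has_real_derivative
     (exp (- (1 / t)) * (1 / t\<^sup>2) * t ^ n - exp (- (1 / t)) * (real n * t ^ (n - 1))) / (t ^ n * t ^ n)) (at t)"
    using t by (auto intro!: derivative_eq_intros simp: power2_eq_square)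
  moreover have "(exp (- (1 / t)) * (1 / t\<^sup>2) * t ^ n - exp (- (1 / t)) * (real n * t ^ (n - 1))) / (t ^ n * t ^ n)
     = flat_exp (n + 2) t - real n * flat_exp (n + 1) t"
    using t by (cases n) (simp_all add: flat_exp_def field_simps power2_eq_square)
  ultimately have "((\<lambda>t. exp (- (1 / t)) / t ^ n) has_real_derivative
      flat_exp (n + 2) t - real n * flat_exp (n + 1) t) (at t)" by simp
  then show ?thesis
    by (rule has_field_derivative_transform_within_open[of _ _ _ "{0<..}"])
      (use t in \<open>auto simp: flat_exp_def\<close>)
qed

lemma continuous_on_flat_exp [continuous_intros]:
  "continuous_on S f \<Longrightarrow> continuous_on S (\<lambda>x. flat_exp n (f x))"
  by (rule continuous_on_compose2[of UNIV "flat_exp n" S f])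
     (auto intro!: continuous_at_imp_continuous_on DERIV_isCont[OF DERIV_flat_exp])

text \<open>
  A class of functions supported in a ball that contains its own directional derivatives. All its
  members are then smooth, without any formula for the higher derivatives.
\<close>

inductive bump_class :: "'a::euclidean_space \<Rightarrow> real \<Rightarrow> ('a \<Rightarrow> real) \<Rightarrow> bool" for c r where
  profile: "bump_class c r (\<lambda>x. flat_exp n (r\<^sup>2 - (x - c) \<bullet> (x - c)))"
| coordinate: "bump_class c r f \<Longrightarrow> bump_class c r (\<lambda>x. ((x - c) \<bullet> v) * f x)"
| scale: "bump_class c r f \<Longrightarrow> bump_class c r (\<lambda>x. a * f x)"
| sum: "bump_class c r f \<Longrightarrow> bump_class c r g \<Longrightarrow> bump_class c r (\<lambda>x. f x + g x)"

lemma has_derivative_profile: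
  "((\<lambda>x. flat_exp n (r\<^sup>2 - (x - c) \<bullet> (x - c))) has_derivative
    (\<lambda>v. (flat_exp (n + 2) (r\<^sup>2 - (x - c) \<bullet> (x - c)) -
      real n * flat_exp (n + 1) (r\<^sup>2 - (x - c) \<bullet> (x - c))) * (- 2 * ((x - c) \<bullet> v)))) (at x)"
proof -
  have "((\<lambda>x. r\<^sup>2 - (x - c) \<bullet> (x - c)) has_derivative (\<lambda>v. - 2 * ((x - c) \<bullet> v))) (at x)"
    by (auto intro!: derivative_eq_intros simp: fun_eq_iff inner_commute)
  then show ?thesis
    using DERIV_flat_exp[of n "r\<^sup>2 - (x - c) \<bullet> (x - c)", unfolded has_field_derivative_def]
    by (rule has_derivative_compose)
qed

lemma bump_class_derivative:
  assumes "bump_class c r f"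
  shows "\<exists>f'. (\<forall>x. (f has_derivative f' x) (at x)) \<and> (\<forall>v. bump_class c r (\<lambda>x. f' x v))"
  using assms
proof induction
  case (profile n)
  have eq: "(flat_exp (n + 2) (r\<^sup>2 - (x - c) \<bullet> (x - c)) -
      real n * flat_exp (n + 1) (r\<^sup>2 - (x - c) \<bullet> (x - c))) * (- 2 * ((x - c) \<bullet> v)) =
      (- 2) * (((x - c) \<bullet> v) * (flat_exp (n + 2) (r\<^sup>2 - (x - c) \<bullet> (x - c)) +
        (- real n) * flat_exp (n + 1) (r\<^sup>2 - (x - c) \<bullet> (x - c))))" for x v
    by algebra
  have "bump_class c r (\<lambda>x. (flat_exp (n + 2) (r\<^sup>2 - (x - c) \<bullet> (x - c)) -
      real n * flat_exp (n + 1) (r\<^sup>2 - (x - c) \<bullet> (x - c))) * (- 2 * ((x - c) \<bullet> v)))" for v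
    unfolding eq by (intro bump_class.intros)
  then show ?case
    using has_derivative_profile[of n r c]
    by (intro exI[of _ "\<lambda>x v. (flat_exp (n + 2) (r\<^sup>2 - (x - c) \<bullet> (x - c)) -
      real n * flat_exp (n + 1) (r\<^sup>2 - (x - c) \<bullet> (x - c))) * (- 2 * ((x - c) \<bullet> v))"]) auto
next
  case (coordinate f w)
  then obtain f' where f': "\<And>x. (f has_derivative f' x) (at x)"
    and c: "\<And>v. bump_class c r (\<lambda>x. f' x v)" by blast
  have "((\<lambda>x. ((x - c) \<bullet> w) * f x) has_derivative (\<lambda>v. (v \<bullet> w) * f x + ((x - c) \<bullet> w) * f' x v)) (at x)" for x
    by (auto intro!: derivative_eq_intros f' simp: fun_eq_iff)
  moreover have "bump_class c r (\<lambda>x. (v \<bullet> w) * f x + ((x - c) \<bullet> w) * f' x v)" for v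
    by (intro bump_class.intros coordinate c)
  ultimately show ?case
    by (intro exI[of _ "\<lambda>x v. (v \<bullet> w) * f x + ((x - c) \<bullet> w) * f' x v"]) auto
next
  case (scale f a)
  then obtain f' where f': "\<And>x. (f has_derivative f' x) (at x)"
    and c: "\<And>v. bump_class c r (\<lambda>x. f' x v)" by blast
  have "((\<lambda>x. a * f x) has_derivative (\<lambda>v. a * f' x v)) (at x)" for x
    by (auto intro!: derivative_eq_intros f')
  then show ?case
    using bump_class.scale[OF c] by (intro exI[of _ "\<lambda>x v. a * f' x v"]) auto
next
  case (sum f g)
  then obtain f' g' where "\<And>x. (f has_derivative f' x) (at x)" "\<And>x. (g has_derivative g' x) (at x)"
    "\<And>v. bump_class c r (\<lambda>x. f' x v)" "\<And>v. bump_class c r (\<lambda>x. g' x v)" by blast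
  then have "(\<forall>x. ((\<lambda>x. f x + g x) has_derivative (\<lambda>v. f' x v + g' x v)) (at x)) \<and>
     (\<forall>v. bump_class c r (\<lambda>x. f' x v + g' x v))"
    by (auto intro!: has_derivative_add bump_class.sum)
  then show ?case
    by (intro exI[of _ "\<lambda>x v. f' x v + g' x v"])
qed

lemma bump_class_Ck:
  assumes "bump_class c r f"
  shows "Ck k f"
  using assms
proof (induction k arbitrary: f)
  case 0
  then show ?case
    using bump_class_derivative[OF 0] has_derivative_continuous
    by (metis Ck.simps(1) continuous_at_imp_continuous_on)
next
  case (Suc k)
  obtain f' where f': "\<And>x. (f has_derivative f' x) (at x)"
    and c: "\<And>v. bump_class c r (\<lambda>x. f' x v)" using bump_class_derivative[OF Suc.prems] by blast
  have "frechet_derivative f (at x) = f' x" for x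
    using frechet_derivative_at[OF f'] by simp
  then show ?case
    using Suc.IH[OF c] f' by (auto simp: differentiable_def)
qed

definition bump :: "'a::euclidean_space \<Rightarrow> real \<Rightarrow> 'a \<Rightarrow> real" where
  "bump c r x = flat_exp 0 (r\<^sup>2 - (x - c) \<bullet> (x - c))"

lemma bump_nonneg: "0 \<le> bump c r x"
  by (simp add: bump_def flat_exp_nonneg)

lemma flat_exp_outside_ball:
  assumes "r > 0" "x \<notin> ball c r"
  shows "flat_exp n (r\<^sup>2 - (x - c) \<bullet> (x - c)) = 0"
proof -
  have "r\<^sup>2 \<le> (norm (x - c))\<^sup>2"
    using assms by (intro power_mono) (auto simp: dist_norm norm_minus_commute)
  then show ?thesis
    by (simp add: flat_exp_def power2_norm_eq_inner)
qed

lemma bump_outside_ball: "r > 0 \<Longrightarrow> x \<notin> ball c r \<Longrightarrow> bump c r x = 0"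
  unfolding bump_def by (rule flat_exp_outside_ball)

lemma continuous_on_bump: "continuous_on S (bump c r)"
  unfolding bump_def by (intro continuous_intros)

lemma test_function_bump:
  assumes "r > 0"
  shows "test_function (bump c r)"
proof -
  have "bump_class c r (bump c r)"
    unfolding bump_def by (rule bump_class.profile)
  moreover have "{x. bump c r x \<noteq> 0} \<subseteq> ball c r"
    using bump_outside_ball[OF assms] by blast
  then have "bounded {x. bump c r x \<noteq> 0}"
    using bounded_subset bounded_ball by blast
  ultimately show ?thesis
    unfolding test_function_def using bump_class_Ck by auto
qed

lemma frechet_derivative_bump:
  "frechet_derivative (bump c r) (at x) v =
    - 2 * ((x - c) \<bullet> v) * flat_exp 2 (r\<^sup>2 - (x - c) \<bullet> (x - c))"
proof -
  have "(bump c r has_derivative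
    (\<lambda>v. - 2 * ((x - c) \<bullet> v) * flat_exp 2 (r\<^sup>2 - (x - c) \<bullet> (x - c)))) (at x)"
    using has_derivative_profile[of 0 r c x] unfolding bump_def
    by (rule has_derivative_eq_rhs) (simp add: fun_eq_iff numeral_2_eq_2[symmetric])
  from frechet_derivative_at[OF this] show ?thesis by metis
qed

section \<open>Continuous fields with bounded weak derivatives are Lipschitz\<close>

lemma integral_continuous_supported:
  fixes f :: "'a::euclidean_space \<Rightarrow> real"
  assumes f: "continuous_on UNIV f" and zero: "\<And>x. x \<notin> cbox a b \<Longrightarrow> f x = 0"
  shows "integrable lebesgue f" "(LINT x|lebesgue. f x) = integral (cbox a b) f"
proof -
  have eq: "(\<lambda>x. indicator (cbox a b) x *\<^sub>R f x) = f"
    using zero by (auto simp: fun_eq_iff indicator_def)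
  have "integrable lborel f"
    using borel_integrable_compact[OF compact_cbox continuous_on_subset[OF f subset_UNIV], of a b]
    unfolding eq .
  then show int: "integrable lebesgue f"
    using f by (subst integrable_completion) (auto intro: borel_measurable_continuous_onI)
  have "(LINT x|lebesgue. f x) = integral UNIV f"
    using integral_lebesgue[OF int] by simp
  also have "\<dots> = integral UNIV (\<lambda>x. if x \<in> cbox a b then f x else 0)"
    using zero by (intro arg_cong[of _ _ "integral UNIV"]) auto
  also have "\<dots> = integral (cbox a b) f"
    by (rule Henstock_Kurzweil_Integration.integral_restrict_UNIV)
  finally show "(LINT x|lebesgue. f x) = integral (cbox a b) f" .
qed

lemma integrable_mult_bump:
  fixes g :: "'a::euclidean_space \<Rightarrow> real"
  assumes "continuous_on UNIV g" "r > 0"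
  shows "integrable lebesgue (\<lambda>x. g x * bump c r x)"
proof -
  obtain a where "ball c r \<subseteq> cbox (-a) a"
    using bounded_subset_cbox_symmetric[OF bounded_ball] by blast
  then have "bump c r x = 0" if "x \<notin> cbox (-a) a" for x
    using bump_outside_ball[OF assms(2)] that by blast
  then show ?thesis
    by (intro integral_continuous_supported(1)[of _ "-a" a] continuous_intros assms continuous_on_bump) auto
qed

lemma integrable_bump: "r > 0 \<Longrightarrow> integrable lebesgue (bump c r)"
  using integrable_mult_bump[of "\<lambda>_. 1" r c] by simp

lemma integral_bump_pos:
  assumes "r > 0"
  shows "0 < (LINT x|lebesgue. bump c r x)"
proof (rule ccontr)
  assume "\<not> ?thesis"
  then have "(LINT x|lebesgue. bump c r x) = 0"
    using integral_nonneg_AE[where M = lebesgue and f = "bump c r"] bump_nonneg[of c r] by (simp add: not_less antisym)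
  then have "AE x in lebesgue. bump c r x = 0"
    using integral_nonneg_eq_0_iff_AE[OF integrable_bump[OF assms]] bump_nonneg[of c r] by auto
  then have "AE x in lebesgue. x \<in> {x. bump c r x = 0}" by simp
  moreover have "closed {x. bump c r x = 0}"
    by (intro closed_Collect_eq continuous_on_bump continuous_on_const)
  ultimately have "c \<in> {x. bump c r x = 0}"
    using mem_closed_if_AE_lebesgue by blast
  then show False
    using assms by (simp add: bump_def flat_exp_def)
qed

lemma integral_bump_translate:
  "(LINT x|lebesgue. bump (c + v) r x) = (LINT x|lebesgue. bump c r x)"
proof -
  have m[measurable]: "bump c r \<in> borel_measurable borel" for c :: 'a
    by (intro borel_measurable_continuous_onI continuous_on_bump)
  have "(LINT x|lebesgue. bump (c + v) r x) = (LINT x|distr lborel borel ((+) v). bump (c + v) r x)"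
    unfolding lborel_distr_plus by (subst integral_completion) auto
  also have "\<dots> = (LINT x|lborel. bump (c + v) r (v + x))"
    by (rule integral_distr) auto
  also have "\<dots> = (LINT x|lborel. bump c r x)"
    by (simp add: bump_def algebra_simps)
  finally show ?thesis by (subst integral_completion) auto
qed

text \<open>
  Moving the bump from \<open>c\<close> to \<open>c + v\<close> changes the average of \<open>g\<close> at the rate
  \<open>- (LINT x|lebesgue. g x * D bump x v)\<close>, where \<open>D bump x v\<close> is the derivative of the bump in the direction \<open>v\<close>.
  The definition of weak derivatives turns this rate into an average of the bounded functions \<open>h i\<close>.
  Moving the bump rather than \<open>g\<close> is what permits the differentiation, as \<open>g\<close> is merely continuous.
\<close>

lemma bump_average_increment:
  fixes g :: "'a::euclidean_space \<Rightarrow> real"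
  assumes g: "continuous_on UNIV g"
    and h: "\<And>i. i \<in> Basis \<Longrightarrow> weak_partial i g (h i)"
    and hm: "\<And>i. i \<in> Basis \<Longrightarrow> h i \<in> borel_measurable lebesgue"
    and C: "\<And>i. i \<in> Basis \<Longrightarrow> AE x in lebesgue. \<bar>h i x\<bar> \<le> C i"
    and r: "0 < r"
  shows "\<bar>(LINT x|lebesgue. g x * bump (c + v) r x) - (LINT x|lebesgue. g x * bump c r x)\<bar>
    \<le> (\<Sum>i\<in>Basis. \<bar>v \<bullet> i\<bar> * C i) * (LINT x|lebesgue. bump c r x)"
proof -
  define p where "p s = c + s *\<^sub>R v" for s
  define P where "P s x = 2 * ((x - p s) \<bullet> v) * flat_exp 2 (r\<^sup>2 - (x - p s) \<bullet> (x - p s))" for s x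
  define J where "J = (LINT x|lebesgue. bump c r x)"
  \<comment> \<open>One box contains the supports of all the bumps on the way from \<open>c\<close> to \<open>c + v\<close>.\<close>
  obtain a where a: "cball c (norm v + r) \<subseteq> cbox (-a) a"
    using bounded_subset_cbox_symmetric[OF bounded_cball] by blast
  have out: "x \<notin> ball (p s) r" if "x \<notin> cbox (-a) a" "s \<in> {0..1}" for x s
  proof
    assume "x \<in> ball (p s) r"
    moreover have "dist c (p s) \<le> norm v"
      using that(2) by (simp add: p_def dist_norm mult_left_le_one_le)
    ultimately have "x \<in> cball c (norm v + r)"
      using dist_triangle[of c x "p s"] by auto
    then show False using a that(1) by blast
  qed
  have contP: "continuous_on UNIV (\<lambda>x. g x * P s x)" for s
    unfolding P_def by (intro continuous_intros g)
  have zeroP: "g x * P s x = 0" if "x \<notin> cbox (-a) a" "s \<in> {0..1}" for x s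
    using flat_exp_outside_ball[OF r out[OF that]] by (simp add: P_def)
  have der: "((\<lambda>s. bump (p s) r x) has_vector_derivative P s x) (at s within U)" for s x U
  proof -
    have "((\<lambda>s. x - p s) has_derivative (\<lambda>h. - (h *\<^sub>R v))) (at s within U)"
      unfolding p_def by (auto intro!: derivative_eq_intros)
    from has_derivative_diff[OF has_derivative_const has_derivative_inner[OF this this]]
    have "((\<lambda>s. r\<^sup>2 - (x - p s) \<bullet> (x - p s)) has_derivative
        (\<lambda>h. 0 - ((x - p s) \<bullet> - (h *\<^sub>R v) + - (h *\<^sub>R v) \<bullet> (x - p s)))) (at s within U)" .
    then have "((\<lambda>s. r\<^sup>2 - (x - p s) \<bullet> (x - p s)) has_real_derivative 2 * ((x - p s) \<bullet> v)) (at s within U)"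
      unfolding has_field_derivative_def
      by (rule has_derivative_eq_rhs) (simp add: fun_eq_iff inner_commute[of v])
    from DERIV_chain2[OF DERIV_flat_exp[of 0] this]
    show ?thesis
      unfolding bump_def P_def has_real_derivative_iff_has_vector_derivative[symmetric]
      by (simp add: mult.commute numeral_2_eq_2[symmetric])
  qed
  have cont2: "continuous_on S (\<lambda>(s, x). g x * P s x)" for S
  proof -
    have "continuous_on S (\<lambda>z. g (snd z))"
      by (rule continuous_on_compose2[OF g continuous_on_snd[OF continuous_on_id]]) auto
    then show ?thesis
      unfolding P_def p_def case_prod_beta by (intro continuous_intros)
  qed
  have F': "((\<lambda>s. integral (cbox (-a) a) (\<lambda>x. g x * bump (p s) r x)) has_vector_derivative
      integral (cbox (-a) a) (\<lambda>x. g x * P s x)) (at s within {0..1})" if "s \<in> {0..1}" for s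
  proof (rule leibniz_rule_vector_derivative)
    show "((\<lambda>s. g x * bump (p s) r x) has_vector_derivative g x * P s x) (at s within {0..1})" for s x
      by (rule has_vector_derivative_mult_right[OF der])
    show "(\<lambda>x. g x * bump (p s) r x) integrable_on cbox (-a) a" for s
      by (intro integrable_continuous continuous_intros continuous_on_bump continuous_on_subset[OF g]) auto
  qed (use that cont2 in auto)
  have F: "integral (cbox (-a) a) (\<lambda>x. g x * bump (p s) r x) = (LINT x|lebesgue. g x * bump (p s) r x)"
    if "s \<in> {0..1}" for s
    using bump_outside_ball[OF r out[OF _ that]]
    by (intro integral_continuous_supported(2)[symmetric] continuous_intros g continuous_on_bump) auto
  have bound: "norm (integral (cbox (-a) a) (\<lambda>x. g x * P s x)) \<le> (\<Sum>i\<in>Basis. \<bar>v \<bullet> i\<bar> * C i) * J"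
    if s: "s \<in> {0..1}" for s
  proof -
    \<comment> \<open>Weak derivatives are given along the coordinate directions, so \<open>v\<close> is expanded in the basis.\<close>
    have Psum: "g x * P s x = - (\<Sum>i\<in>Basis. (v \<bullet> i) * (g x * frechet_derivative (bump (p s) r) (at x) i))" for x
    proof -
      have "(x - p s) \<bullet> v = (\<Sum>i\<in>Basis. (v \<bullet> i) * ((x - p s) \<bullet> i))"
        by (subst euclidean_inner) (simp add: mult.commute)
      then show ?thesis
        unfolding P_def frechet_derivative_bump
        by (simp add: sum_distrib_left sum_distrib_right sum_negf[symmetric] mult_ac)
    qed
    have int: "integrable lebesgue (\<lambda>x. g x * frechet_derivative (bump (p s) r) (at x) i)" for i
      unfolding frechet_derivative_bump
      using flat_exp_outside_ball[OF r out[OF _ s]]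
      by (intro integral_continuous_supported(1)[of _ "-a" a] continuous_intros g) auto
    have bd: "\<bar>LINT x|lebesgue. g x * frechet_derivative (bump (p s) r) (at x) i\<bar> \<le> C i * J"
      if i: "i \<in> Basis" for i
    proof -
      have "\<bar>LINT x|lebesgue. g x * frechet_derivative (bump (p s) r) (at x) i\<bar>
          = \<bar>LINT x|lebesgue. h i x * bump (p s) r x\<bar>"
        using h[OF i] test_function_bump[OF r, of "p s"] unfolding weak_partial_def by simp
      also have "\<dots> \<le> (LINT x|lebesgue. C i * bump (p s) r x)"
      proof -
        have ae: "AE x in lebesgue. norm (h i x * bump (p s) r x) \<le> C i * bump (p s) r x"
          using C[OF i] by eventually_elim (simp add: abs_mult bump_nonneg mult_right_mono)
        have m: "(\<lambda>x. h i x * bump (p s) r x) \<in> borel_measurable lebesgue"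
          using hm[OF i] integrable_bump[OF r, of "p s"] by measurable
        have ii: "integrable lebesgue (\<lambda>x. C i * bump (p s) r x)"
          using integrable_bump[OF r, of "p s"] by simp
        have "integrable lebesgue (\<lambda>x. h i x * bump (p s) r x)"
          by (rule Bochner_Integration.integrable_bound[OF ii m]) (use ae in \<open>eventually_elim, auto\<close>)
        then have "(LINT x|lebesgue. norm (h i x * bump (p s) r x)) \<le> (LINT x|lebesgue. C i * bump (p s) r x)"
          using ii ae by (intro integral_mono_AE) auto
        then show ?thesis
          by (intro order_trans[OF integral_abs_bound]) simp
      qed
      also have "\<dots> = C i * J"
        unfolding p_def J_def by (simp add: integral_bump_translate)
      finally show ?thesis .
    qed
    have "integral (cbox (-a) a) (\<lambda>x. g x * P s x) = (LINT x|lebesgue. g x * P s x)"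
      using zeroP[OF _ s] by (intro integral_continuous_supported(2)[symmetric] contP) auto
    also have "\<dots> = - (\<Sum>i\<in>Basis. (v \<bullet> i) * (LINT x|lebesgue. g x * frechet_derivative (bump (p s) r) (at x) i))"
      unfolding Psum using int by (simp add: Bochner_Integration.integral_sum)
    finally have "norm (integral (cbox (-a) a) (\<lambda>x. g x * P s x))
       \<le> (\<Sum>i\<in>Basis. \<bar>(v \<bullet> i) * (LINT x|lebesgue. g x * frechet_derivative (bump (p s) r) (at x) i)\<bar>)"
      by (simp add: sum_abs)
    also have "\<dots> \<le> (\<Sum>i\<in>Basis. \<bar>v \<bullet> i\<bar> * (C i * J))"
      by (intro sum_mono) (simp add: abs_mult mult_left_mono bd)
    finally show ?thesis
      by (simp add: sum_distrib_right mult.assoc)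
  qed
  have "norm (t *\<^sub>R integral (cbox (-a) a) (\<lambda>x. g x * P s x)) \<le> (\<Sum>i\<in>Basis. \<bar>v \<bullet> i\<bar> * C i) * J * norm t"
    if "s \<in> {0..1}" for s t
    using mult_left_mono[OF bound[OF that], of "\<bar>t\<bar>"] by (simp add: abs_mult mult_ac)
  then have "norm (integral (cbox (-a) a) (\<lambda>x. g x * bump (p 1) r x) - integral (cbox (-a) a) (\<lambda>x. g x * bump (p 0) r x))
     \<le> (\<Sum>i\<in>Basis. \<bar>v \<bullet> i\<bar> * C i) * J * norm (1 - 0 :: real)"
    using F' unfolding has_vector_derivative_def
    by (intro differentiable_bound[of "{0..1}" _ "\<lambda>s t. t *\<^sub>R integral (cbox (-a) a) (\<lambda>x. g x * P s x)"])
       (auto intro!: onorm_le)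
  then show ?thesis
    unfolding F[of 1, simplified] F[of 0, simplified] J_def by (simp add: p_def)
qed

lemma bump_average_approx:
  fixes g :: "'a::euclidean_space \<Rightarrow> real"
  assumes g: "continuous_on UNIV g" and r: "0 < r"
    and e: "\<And>x. x \<in> ball c r \<Longrightarrow> \<bar>g x - g c\<bar> \<le> e"
  shows "\<bar>(LINT x|lebesgue. g x * bump c r x) - g c * (LINT x|lebesgue. bump c r x)\<bar>
    \<le> e * (LINT x|lebesgue. bump c r x)"
proof -
  have int: "integrable lebesgue (\<lambda>x. (g x - g c) * bump c r x)"
    by (intro integrable_mult_bump r continuous_intros g)
  have "(LINT x|lebesgue. g x * bump c r x) - g c * (LINT x|lebesgue. bump c r x)
      = (LINT x|lebesgue. (g x - g c) * bump c r x)"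
    using integrable_mult_bump[OF g r, of c] integrable_bump[OF r, of c] by (simp add: left_diff_distrib)
  also have "\<bar>\<dots>\<bar> \<le> (LINT x|lebesgue. e * bump c r x)"
  proof -
    have "\<bar>(g x - g c) * bump c r x\<bar> \<le> e * bump c r x" for x
      using e[of x] bump_outside_ball[OF r, of x c] bump_nonneg[of c r x]
      by (cases "x \<in> ball c r") (auto simp: abs_mult intro: mult_right_mono)
    then show ?thesis
      using int integrable_bump[OF r, of c]
      by (intro order_trans[OF integral_abs_bound] integral_mono) auto
  qed
  finally show ?thesis by simp
qed

text \<open>
  By continuity of \<open>g\<close>, its averages over small bumps around \<open>c\<close> and \<open>c + v\<close> approximate its values there,
  and the bound on their difference does not depend on the radius.
\<close>

lemma lipschitz_if_weak_partials_bounded: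
  fixes g :: "'a::euclidean_space \<Rightarrow> real"
  assumes g: "continuous_on UNIV g"
    and h: "\<And>i. i \<in> Basis \<Longrightarrow> weak_partial i g (h i)"
    and hm: "\<And>i. i \<in> Basis \<Longrightarrow> h i \<in> borel_measurable lebesgue"
    and C: "\<And>i. i \<in> Basis \<Longrightarrow> AE x in lebesgue. \<bar>h i x\<bar> \<le> C i"
  shows "\<bar>g (c + v) - g c\<bar> \<le> (\<Sum>i\<in>Basis. \<bar>v \<bullet> i\<bar> * C i)"
proof (rule field_le_epsilon)
  fix e :: real assume "e > 0"
  then have "\<exists>d>0. \<forall>x\<in>ball p d. \<bar>g x - g p\<bar> \<le> e / 2" for p
    using g unfolding continuous_on_iff dist_real_def
    by (metis UNIV_I dist_commute half_gt_zero less_eq_real_def mem_ball)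
  then obtain d1 d2 where d: "d1 > 0" "d2 > 0" "\<And>x. x \<in> ball c d1 \<Longrightarrow> \<bar>g x - g c\<bar> \<le> e / 2"
      "\<And>x. x \<in> ball (c + v) d2 \<Longrightarrow> \<bar>g x - g (c + v)\<bar> \<le> e / 2"
    by meson
  define r where "r = min d1 d2"
  define J where "J = (LINT x|lebesgue. bump c r x)"
  have r: "r > 0" using d by (simp add: r_def)
  have J: "J > 0" unfolding J_def by (rule integral_bump_pos[OF r])
  have "\<bar>(LINT x|lebesgue. g x * bump c r x) - g c * J\<bar> \<le> e / 2 * J"
    unfolding J_def by (rule bump_average_approx[OF g r]) (use d r_def in auto)
  moreover have "\<bar>(LINT x|lebesgue. g x * bump (c + v) r x) - g (c + v) * J\<bar> \<le> e / 2 * J"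
    unfolding J_def integral_bump_translate[of c v r, symmetric]
    by (rule bump_average_approx[OF g r]) (use d r_def in auto)
  moreover have "\<bar>(LINT x|lebesgue. g x * bump (c + v) r x) - (LINT x|lebesgue. g x * bump c r x)\<bar>
    \<le> (\<Sum>i\<in>Basis. \<bar>v \<bullet> i\<bar> * C i) * J"
    unfolding J_def by (rule bump_average_increment[OF g h hm C r])
  ultimately have "\<bar>g (c + v) * J - g c * J\<bar> \<le> (\<Sum>i\<in>Basis. \<bar>v \<bullet> i\<bar> * C i) * J + e / 2 * J + e / 2 * J"
    by linarith
  then have "\<bar>g (c + v) * J - g c * J\<bar> \<le> ((\<Sum>i\<in>Basis. \<bar>v \<bullet> i\<bar> * C i) + e) * J"
    by (simp add: algebra_simps)
  then have "\<bar>g (c + v) - g c\<bar> * J \<le> ((\<Sum>i\<in>Basis. \<bar>v \<bullet> i\<bar> * C i) + e) * J"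
    using J by (simp add: left_diff_distrib[symmetric] abs_mult)
  then show "\<bar>g (c + v) - g c\<bar> \<le> (\<Sum>i\<in>Basis. \<bar>v \<bullet> i\<bar> * C i) + e"
    using J by simp
qed

lemma L_infty_continuous_bounded:
  fixes g :: "'a::euclidean_space \<Rightarrow> real"
  assumes "continuous_on UNIV g" "g \<in> L_infty"
  shows "\<exists>B. \<forall>x. \<bar>g x\<bar> \<le> B"
proof -
  obtain B where B: "AE x in lebesgue. \<bar>g x\<bar> \<le> B"
    using assms(2) unfolding L_infty_def by blast
  have "closed {x. \<bar>g x\<bar> \<le> B}"
    using assms(1) by (intro closed_Collect_le continuous_intros)
  then show ?thesis
    using mem_closed_if_AE_lebesgue[of "{x. \<bar>g x\<bar> \<le> B}"] B by auto
qed

lemma W1_infty_lipschitz: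
  fixes g :: "'a::euclidean_space \<Rightarrow> real"
  assumes "continuous_on UNIV g" "g \<in> W1_infty"
  shows "\<exists>L. \<forall>x y. \<bar>g x - g y\<bar> \<le> L * norm (x - y)"
proof -
  have "\<forall>i\<in>Basis. \<exists>h. h \<in> L_infty \<and> weak_partial i g h"
    using assms(2) unfolding W1_infty_def by blast
  then obtain h where h: "\<And>i. i \<in> Basis \<Longrightarrow> h i \<in> L_infty" "\<And>i. i \<in> Basis \<Longrightarrow> weak_partial i g (h i)"
    by metis
  then have "\<forall>i\<in>Basis. \<exists>C. AE x in lebesgue. \<bar>h i x\<bar> \<le> C"
    unfolding L_infty_def by blast
  then obtain C where C: "\<And>i. i \<in> Basis \<Longrightarrow> AE x in lebesgue. \<bar>h i x\<bar> \<le> C i"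
    by metis
  have "\<bar>g x - g y\<bar> \<le> (\<Sum>i\<in>Basis. \<bar>C i\<bar>) * norm (x - y)" for x y
  proof -
    have "\<bar>g (y + (x - y)) - g y\<bar> \<le> (\<Sum>i\<in>Basis. \<bar>(x - y) \<bullet> i\<bar> * C i)"
      using h C by (intro lipschitz_if_weak_partials_bounded assms) (auto simp: L_infty_def)
    also have "\<dots> \<le> (\<Sum>i\<in>Basis. norm (x - y) * \<bar>C i\<bar>)"
    proof (rule sum_mono)
      fix i :: 'a assume "i \<in> Basis"
      then have "\<bar>(x - y) \<bullet> i\<bar> * \<bar>C i\<bar> \<le> norm (x - y) * \<bar>C i\<bar>"
        by (intro mult_right_mono Basis_le_norm) auto
      moreover have "\<bar>(x - y) \<bullet> i\<bar> * C i \<le> \<bar>(x - y) \<bullet> i\<bar> * \<bar>C i\<bar>"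
        by (intro mult_left_mono) auto
      ultimately show "\<bar>(x - y) \<bullet> i\<bar> * C i \<le> norm (x - y) * \<bar>C i\<bar>" by linarith
    qed
    finally show ?thesis by (simp add: sum_distrib_left mult.commute)
  qed
  then show ?thesis by blast
qed

text \<open>
  The form in which the Sobolev regularity of the gradient enters the dynamics: one bound and one Lipschitz
  constant, valid at every point.
\<close>

lemma potential_gradient_bounded_lipschitz:
  assumes "potential_gradient K gK"
  obtains M L where "0 < M" "0 < L" "\<And>x. norm (gK x) \<le> M"
    "\<And>x y. norm (gK x - gK y) \<le> L * norm (x - y)"
proof -
  have cont: "continuous_on UNIV (\<lambda>x. gK x \<bullet> j)" and W: "j \<in> Basis \<Longrightarrow> (\<lambda>x. gK x \<bullet> j) \<in> W1_infty" for j
    using assms unfolding potential_gradient_def W1_infty_field_def by (auto intro!: continuous_intros)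
  have "\<forall>j\<in>Basis. \<exists>B. \<forall>x. \<bar>gK x \<bullet> j\<bar> \<le> B"
    using L_infty_continuous_bounded[OF cont] W unfolding W1_infty_def by blast
  then obtain B where B: "\<And>j x. j \<in> Basis \<Longrightarrow> \<bar>gK x \<bullet> j\<bar> \<le> B j" by metis
  have "\<forall>j\<in>Basis. \<exists>L. \<forall>x y. \<bar>gK x \<bullet> j - gK y \<bullet> j\<bar> \<le> L * norm (x - y)"
    using W1_infty_lipschitz[OF cont] W by blast
  then obtain L where L: "\<And>j x y. j \<in> Basis \<Longrightarrow> \<bar>gK x \<bullet> j - gK y \<bullet> j\<bar> \<le> L j * norm (x - y)" by metis
  show ?thesis
  proof (rule that)
    show "0 < \<bar>\<Sum>j\<in>Basis. B j\<bar> + 1" "0 < \<bar>\<Sum>j\<in>Basis. L j\<bar> + 1" by linarith+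
    show "norm (gK x) \<le> \<bar>\<Sum>j\<in>Basis. B j\<bar> + 1" for x
      using norm_le_l1[of "gK x"] sum_mono[of Basis "\<lambda>j. \<bar>gK x \<bullet> j\<bar>" B] B by fastforce
    show "norm (gK x - gK y) \<le> (\<bar>\<Sum>j\<in>Basis. L j\<bar> + 1) * norm (x - y)" for x y
    proof -
      have "norm (gK x - gK y) \<le> (\<Sum>j\<in>Basis. L j * norm (x - y))"
        using norm_le_l1[of "gK x - gK y"] L
        by (intro order_trans[OF norm_le_l1] sum_mono) (simp add: inner_diff_left)
      also have "\<dots> \<le> (\<bar>\<Sum>j\<in>Basis. L j\<bar> + 1) * norm (x - y)"
        unfolding sum_distrib_right[symmetric] by (intro mult_right_mono) auto
      finally show ?thesis .
    qed
  qed
qed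

section \<open>The Wasserstein distance\<close>

lemma borel_measurable_fst_snd:
  "fst \<in> borel_measurable (borel :: ('a::euclidean_space \<times> 'b::euclidean_space) measure)"
  "snd \<in> borel_measurable (borel :: ('a::euclidean_space \<times> 'b::euclidean_space) measure)"
  by (auto intro!: borel_measurable_continuous_onI continuous_intros)

lemma P1_D:
  assumes "\<mu> \<in> P1"
  shows "prob_space \<mu>" "sets \<mu> = sets borel" "space \<mu> = UNIV" "integrable \<mu> norm"
  using assms sets_eq_imp_space_eq[of \<mu> borel] unfolding P1_def by auto

text \<open>
  Linear growth of the map keeps the first moment finite.
\<close>

lemma P1_distr:
  fixes F :: "'b::euclidean_space \<Rightarrow> 'c::euclidean_space"
  assumes "\<mu> \<in> P1" and F: "continuous_on UNIV F" and "\<And>z. norm (F z) \<le> A + B * norm z"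
  shows "distr \<mu> borel F \<in> P1"
proof -
  note mu = P1_D[OF assms(1)]
  interpret prob_space \<mu> by (rule mu)
  have Fm [measurable]: "F \<in> measurable \<mu> borel"
    using F mu(2) by (simp add: borel_measurable_continuous_onI cong: measurable_cong_sets)
  have "integrable \<mu> (\<lambda>z. norm (F z))"
    by (rule Bochner_Integration.integrable_bound[of \<mu> "\<lambda>z. A + B * norm z"])
      (use mu assms(3) in \<open>auto intro!: AE_I2 order_trans[OF _ abs_ge_self]\<close>)
  then show ?thesis
    unfolding P1_def by (auto intro: prob_space_distr simp: integrable_distr_eq)
qed

text \<open>
  The coupling is the image of \<open>\<mu>\<close> under \<open>z \<mapsto> (F z, G z)\<close>.
\<close>

lemma W1_distr_le:
  fixes F G :: "'b::euclidean_space \<Rightarrow> 'c::euclidean_space"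
  assumes "\<mu> \<in> P1" and F: "continuous_on UNIV F" and G: "continuous_on UNIV G"
  shows "W1 (distr \<mu> borel F) (distr \<mu> borel G) \<le> (\<integral>\<^sup>+ z. ennreal (dist (F z) (G z)) \<partial>\<mu>)"
proof -
  note mu = P1_D[OF assms(1)] and borel_measurable_fst_snd[measurable]
  interpret prob_space \<mu> by (rule mu)
  have m[measurable]: "F \<in> measurable \<mu> borel" "G \<in> measurable \<mu> borel"
    using F G mu(2) by (simp_all add: borel_measurable_continuous_onI cong: measurable_cong_sets)
  have FG[measurable]: "(\<lambda>z. (F z, G z)) \<in> measurable \<mu> borel"
    by measurable
  define \<pi> where "\<pi> = distr \<mu> borel (\<lambda>z. (F z, G z))"
  have "\<pi> \<in> couplings (distr \<mu> borel F) (distr \<mu> borel G)"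
    unfolding couplings_def \<pi>_def by (auto intro!: prob_space_distr simp: distr_distr[OF _ FG] borel_measurable_fst_snd comp_def)
  then have "W1 (distr \<mu> borel F) (distr \<mu> borel G) \<le> (\<integral>\<^sup>+ z. ennreal (dist (fst z) (snd z)) \<partial>\<pi>)"
    unfolding W1_def by (rule INF_lower)
  also have "\<dots> = (\<integral>\<^sup>+ z. ennreal (dist (F z) (G z)) \<partial>\<mu>)"
    unfolding \<pi>_def by (subst nn_integral_distr) auto
  finally show ?thesis .
qed

text \<open>
  Dominated convergence, applied to the cost of the coupling in \<open>W1_distr_le\<close>.
\<close>

lemma W1_distr_tendsto:
  fixes F :: "nat \<Rightarrow> 'b::euclidean_space \<Rightarrow> 'c::euclidean_space"
  assumes "\<mu> \<in> P1" and F: "\<And>n. continuous_on UNIV (F n)" and H: "continuous_on UNIV H"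
    and lim: "\<And>z. (\<lambda>n. F n z) \<longlonglongrightarrow> H z"
    and dom: "\<And>n z. dist (F n z) (H z) \<le> A + B * norm z"
  shows "(\<lambda>n. W1 (distr \<mu> borel (F n)) (distr \<mu> borel H)) \<longlonglongrightarrow> 0"
proof (rule tendsto_sandwich[where f = "\<lambda>_. 0"])
  note mu = P1_D[OF assms(1)]
  interpret prob_space \<mu> by (rule mu)
  have [measurable]: "F n \<in> measurable \<mu> borel" "H \<in> measurable \<mu> borel" for n
    using F H mu(2) by (simp_all add: borel_measurable_continuous_onI cong: measurable_cong_sets)
  have int: "integrable \<mu> (\<lambda>z. A + B * norm z)"
    using mu(4) by auto
  show "(\<lambda>n. \<integral>\<^sup>+ z. ennreal (dist (F n z) (H z)) \<partial>\<mu>) \<longlonglongrightarrow> 0"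
  proof -
    have "(\<lambda>n. \<integral>\<^sup>+ z. ennreal (dist (F n z) (H z)) \<partial>\<mu>) \<longlonglongrightarrow> (\<integral>\<^sup>+ z. 0 \<partial>\<mu>)"
    proof (rule nn_integral_dominated_convergence)
      show "(\<lambda>z. ennreal (A + B * norm z)) \<in> borel_measurable \<mu>"
        using int by measurable
      show "AE z in \<mu>. ennreal (dist (F n z) (H z)) \<le> ennreal (A + B * norm z)" for n
        using dom by (intro AE_I2 ennreal_leI)
      show "(\<integral>\<^sup>+ z. ennreal (A + B * norm z) \<partial>\<mu>) < \<infinity>"
        using integrableD(2)[OF int] dom[of 0] order_trans[OF zero_le_dist dom]
        by (simp add: top.not_eq_extremum)
      show "AE z in \<mu>. (\<lambda>n. ennreal (dist (F n z) (H z))) \<longlonglongrightarrow> 0"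
      proof (rule AE_I2)
        fix z
        show "(\<lambda>n. ennreal (dist (F n z) (H z))) \<longlonglongrightarrow> 0"
          using tendsto_ennrealI[OF tendsto_dist[OF lim[of z] tendsto_const[of "H z"]]] by simp
      qed
    qed measurable
    then show ?thesis by simp
  qed
  show "\<forall>\<^sub>F n in sequentially. W1 (distr \<mu> borel (F n)) (distr \<mu> borel H)
      \<le> (\<integral>\<^sup>+ z. ennreal (dist (F n z) (H z)) \<partial>\<mu>)"
    using W1_distr_le[OF assms(1) F H] by simp
qed (auto)

text \<open>
  The easy half of Kantorovich duality, for a vector-valued integrand: integrate the Lipschitz estimate
  against a nearly optimal coupling.
\<close>

lemma integral_diff_le_W1:
  fixes g :: "'a::euclidean_space \<Rightarrow> 'b::euclidean_space"
  assumes "\<mu> \<in> P1" "\<nu> \<in> P1" and bd: "\<And>x. norm (g x) \<le> B"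
    and lip: "\<And>x y. norm (g x - g y) \<le> L * norm (x - y)" and W: "W1 \<mu> \<nu> < ennreal r"
    and L: "0 \<le> L"
  shows "norm ((LINT x|\<mu>. g x) - (LINT x|\<nu>. g x)) \<le> L * r"
proof -
  obtain \<pi> where pi: "\<pi> \<in> couplings \<mu> \<nu>" and c: "(\<integral>\<^sup>+ z. ennreal (dist (fst z) (snd z)) \<partial>\<pi>) < ennreal r"
    using W unfolding W1_def INF_less_iff by blast
  have pi': "prob_space \<pi>" "sets \<pi> = sets borel" "distr \<pi> borel fst = \<mu>" "distr \<pi> borel snd = \<nu>"
    using pi unfolding couplings_def by auto
  interpret prob_space \<pi> by (rule pi')
  have r: "0 \<le> r"
    using c by (metis ennreal_neg linorder_not_le not_less_zero order.strict_implies_order)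
  have "L-lipschitz_on UNIV g"
    using lip L by (intro lipschitz_onI) (auto simp: dist_norm)
  then have gm[measurable]: "g \<in> borel_measurable borel"
    by (intro borel_measurable_continuous_onI lipschitz_on_continuous_on)
  have fm[measurable]: "fst \<in> measurable \<pi> borel" "snd \<in> measurable \<pi> borel"
    using pi'(2) by (simp_all add: borel_measurable_fst_snd cong: measurable_cong_sets)
  have i: "integrable \<pi> (\<lambda>z. g (fst z))" "integrable \<pi> (\<lambda>z. g (snd z))"
    using bd by (auto intro!: integrable_const_bound[of _ B])
  have "(LINT x|\<mu>. g x) - (LINT x|\<nu>. g x) = (LINT z|\<pi>. g (fst z) - g (snd z))"
    unfolding pi'(3,4)[symmetric] using i by (simp add: integral_distr)
  then have "ennreal (norm ((LINT x|\<mu>. g x) - (LINT x|\<nu>. g x)))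
      \<le> (\<integral>\<^sup>+ z. ennreal (norm (g (fst z) - g (snd z))) \<partial>\<pi>)"
    using i by (simp only:) (intro integral_norm_bound_ennreal Bochner_Integration.integrable_diff)
  also have "\<dots> \<le> (\<integral>\<^sup>+ z. ennreal L * ennreal (dist (fst z) (snd z)) \<partial>\<pi>)"
    using lip L by (intro nn_integral_mono) (auto simp: dist_norm ennreal_mult[symmetric])
  also have "\<dots> = ennreal L * (\<integral>\<^sup>+ z. ennreal (dist (fst z) (snd z)) \<partial>\<pi>)"
    by (rule nn_integral_cmult) measurable
  also have "\<dots> \<le> ennreal L * ennreal r"
    using c by (intro mult_left_mono) auto
  also have "\<dots> = ennreal (L * r)"
    using L r by (simp add: ennreal_mult)
  finally show ?thesis
    using L r by (simp add: ennreal_le_iff)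
qed

lemma W1_tendsto_imp_integral_tendsto:
  fixes g :: "'a::euclidean_space \<Rightarrow> 'b::euclidean_space"
  assumes "\<forall>\<^sub>F i in F. \<mu> i \<in> P1" "\<nu> \<in> P1" and "\<And>x. norm (g x) \<le> B"
    and "\<And>x y. norm (g x - g y) \<le> L * norm (x - y)" and "0 \<le> L"
    and W: "((\<lambda>i. W1 (\<mu> i) \<nu>) \<longlongrightarrow> 0) F"
  shows "((\<lambda>i. LINT x|\<mu> i. g x) \<longlongrightarrow> (LINT x|\<nu>. g x)) F"
proof (rule tendstoI)
  fix e :: real assume e: "e > 0"
  define r where "r = e / (L + 1)"
  have r: "r > 0" "L * r < e"
    using e \<open>0 \<le> L\<close> by (auto simp: r_def field_simps)
  have "\<forall>\<^sub>F i in F. W1 (\<mu> i) \<nu> < ennreal r"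
    using order_tendstoD(2)[OF W, of "ennreal r"] r by simp
  with assms(1) show "\<forall>\<^sub>F i in F. dist (LINT x|\<mu> i. g x) (LINT x|\<nu>. g x) < e"
  proof eventually_elim
    case (elim i)
    then have "norm ((LINT x|\<mu> i. g x) - (LINT x|\<nu>. g x)) \<le> L * r"
      using assms by (intro integral_diff_le_W1) auto
    then show ?case using r by (simp add: dist_norm)
  qed
qed

text \<open>
  The Lipschitz functions \<open>max 0 (1 - n * infdist x C)\<close> decrease to the indicator of a closed set \<open>C\<close>, and
  the closed sets generate the Borel sets.
\<close>

lemma eq_if_lipschitz_integrals_eq:
  fixes \<mu> \<nu> :: "'a::euclidean_space measure"
  assumes "\<mu> \<in> P1" "\<nu> \<in> P1"
    and eq: "\<And>(g :: 'a \<Rightarrow> real) L. (\<And>x. \<bar>g x\<bar> \<le> 1) \<Longrightarrow> 0 \<le> L \<Longrightarrow>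
        (\<And>x y. \<bar>g x - g y\<bar> \<le> L * norm (x - y)) \<Longrightarrow> (LINT x|\<mu>. g x) = (LINT x|\<nu>. g x)"
  shows "\<mu> = \<nu>"
proof -
  note mu = P1_D[OF assms(1)] and nu = P1_D[OF assms(2)]
  define g :: "'a set \<Rightarrow> nat \<Rightarrow> 'a \<Rightarrow> real"
    where "g C n x = max 0 (1 - real n * infdist x C)" for C n x
  have gb: "\<bar>g C n x\<bar> \<le> 1" for C n x
    unfolding g_def using infdist_nonneg[of x C] by (auto simp: max_def)
  have gl: "\<bar>g C n x - g C n y\<bar> \<le> real n * norm (x - y)" for C n x y
  proof -
    have "\<bar>infdist x C - infdist y C\<bar> \<le> norm (x - y)"
      using infdist_triangle_abs[of x C y] by (simp add: dist_norm)
    then have "\<bar>real n * infdist x C - real n * infdist y C\<bar> \<le> real n * norm (x - y)"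
      unfolding right_diff_distrib[symmetric] by (simp add: abs_mult mult_left_mono)
    then show ?thesis unfolding g_def by (auto simp: max_def)
  qed
  have lim: "(\<lambda>n. LINT x|M. g C n x) \<longlonglongrightarrow> measure M C"
    if M: "M \<in> P1" and C: "closed C" "C \<noteq> {}" for M C
  proof -
    note MD = P1_D[OF M]
    interpret prob_space M by (rule MD)
    have gm: "g C n \<in> borel_measurable M" for n
      using MD(2) unfolding g_def
      by (simp add: borel_measurable_continuous_onI continuous_intros cong: measurable_cong_sets)
    have pt: "(\<lambda>n. g C n x) \<longlonglongrightarrow> indicator C x" for x
    proof (cases "x \<in> C")
      case True
      then show ?thesis using C by (simp add: g_def)
    next
      case False
      then have d: "infdist x C > 0"
        using C by (simp add: infdist_pos_not_in_closed)
      obtain N where N: "1 / infdist x C < real N" using reals_Archimedean2 by blast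
      have "g C n x = 0" if "n \<ge> N" for n
      proof -
        have "1 < real N * infdist x C" using N d by (simp add: divide_less_eq)
        also have "\<dots> \<le> real n * infdist x C" using that d by (intro mult_right_mono) auto
        finally show ?thesis by (simp add: g_def)
      qed
      then have "\<forall>\<^sub>F n in sequentially. g C n x = 0"
        unfolding eventually_sequentially by blast
      then show ?thesis using False by (simp add: tendsto_eventually)
    qed
    have "(\<lambda>n. LINT x|M. g C n x) \<longlonglongrightarrow> (LINT x|M. indicator C x)"
      by (rule integral_dominated_convergence[where w = "\<lambda>_. 1"])
        (use gb gm pt borel_closed[OF C(1)] MD(2) in \<open>auto\<close>)
    then show ?thesis using C MD by (simp add: borel_closed)
  qed
  have "emeasure \<mu> C = emeasure \<nu> C" if C: "closed C" for C
  proof (cases "C = {}")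
    case False
    have "(\<lambda>n. LINT x|\<mu>. g C n x) \<longlonglongrightarrow> measure \<nu> C"
      using lim[OF assms(2) C False] eq[of "g C _", OF gb _ gl] by simp
    with lim[OF assms(1) C False] have "measure \<mu> C = measure \<nu> C"
      by (rule LIMSEQ_unique)
    then show ?thesis
      using mu(1) nu(1) by (simp add: finite_measure.emeasure_eq_measure prob_space.finite_measure)
  qed simp
  moreover have "sets (borel :: 'a measure) = sigma_sets UNIV (Collect closed)"
    unfolding borel_eq_closed by (rule sets_measure_of) auto
  moreover have "emeasure \<mu> UNIV \<noteq> \<infinity>"
    using mu(1) by (simp add: finite_measure.emeasure_eq_measure prob_space.finite_measure)
  ultimately show ?thesis
    using mu(2) nu(2) by (intro measure_eqI_generator_eq[of "Collect closed" UNIV _ _ "\<lambda>_. UNIV"])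
      (auto simp: Int_stable_def)
qed

lemma W1_limit_unique:
  fixes \<mu> :: "'i \<Rightarrow> 'a::euclidean_space measure"
  assumes "\<forall>\<^sub>F i in F. \<mu> i \<in> P1" "\<nu>1 \<in> P1" "\<nu>2 \<in> P1" "F \<noteq> bot"
    and "((\<lambda>i. W1 (\<mu> i) \<nu>1) \<longlongrightarrow> 0) F" "((\<lambda>i. W1 (\<mu> i) \<nu>2) \<longlongrightarrow> 0) F"
  shows "\<nu>1 = \<nu>2"
proof (rule eq_if_lipschitz_integrals_eq[OF assms(2,3)])
  fix g :: "'a \<Rightarrow> real" and L
  assume "\<And>x. \<bar>g x\<bar> \<le> 1" "0 \<le> L" "\<And>x y. \<bar>g x - g y\<bar> \<le> L * norm (x - y)"
  then show "(LINT x|\<nu>1. g x) = (LINT x|\<nu>2. g x)"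
    using W1_tendsto_imp_integral_tendsto[OF assms(1,2) _ _ _ assms(5), of g 1 L]
      W1_tendsto_imp_integral_tendsto[OF assms(1,3) _ _ _ assms(6), of g 1 L]
    by (auto intro: tendsto_unique[OF assms(4)])
qed

section \<open>Gronwall's inequality and the Picard-Lindelof theorem\<close>

lemma norm_increment_le:
  fixes u :: "real \<Rightarrow> 'a::euclidean_space"
  assumes "a \<le> b"
    and u: "\<And>s. s \<in> {a..b} \<Longrightarrow> (u has_vector_derivative u' s) (at s within {a..b})"
    and g: "\<And>s. s \<in> {a..b} \<Longrightarrow> (g has_real_derivative g' s) (at s within {a..b})"
    and le: "\<And>s. s \<in> {a..b} \<Longrightarrow> norm (u' s) \<le> g' s"
  shows "norm (u b - u a) \<le> g b - g a"
proof -
  have U: "(u' has_integral (u b - u a)) {a..b}"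
    using assms by (intro fundamental_theorem_of_calculus) auto
  have G: "(g' has_integral (g b - g a)) {a..b}"
    using assms by (intro fundamental_theorem_of_calculus)
      (auto simp: has_real_derivative_iff_has_vector_derivative)
  have "norm (integral {a..b} u') \<le> integral {a..b} g'"
    using U G le by (intro Henstock_Kurzweil_Integration.integral_norm_bound_integral) auto
  then show ?thesis
    using U G by (simp add: integral_unique)
qed

text \<open>
  The function \<open>h s = norm (u 0) + \<integral>\<^sub>0\<^sup>s (\<kappa> * norm (u r) + \<eta> r) dr\<close> dominates \<open>norm \<circ> u\<close>, and
  \<open>exp (- \<kappa> * s) * h s - \<integral>\<^sub>0\<^sup>s \<eta>\<close> is decreasing. Working with \<open>h\<close> avoids differentiating the norm.
\<close>

lemma gronwall:
  fixes u :: "real \<Rightarrow> 'a::euclidean_space"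
  assumes t: "0 \<le> t" and lam: "0 \<le> \<kappa>"
    and u: "\<And>s. s \<in> {0..t} \<Longrightarrow> (u has_vector_derivative u' s) (at s within {0..t})"
    and \<eta>: "continuous_on {0..t} \<eta>" "\<And>s. s \<in> {0..t} \<Longrightarrow> 0 \<le> \<eta> s"
    and le: "\<And>s. s \<in> {0..t} \<Longrightarrow> norm (u' s) \<le> \<kappa> * norm (u s) + \<eta> s"
  shows "norm (u t) \<le> (norm (u 0) + integral {0..t} \<eta>) * exp (\<kappa> * t)"
proof -
  define h where "h s = norm (u 0) + integral {0..s} (\<lambda>r. \<kappa> * norm (u r) + \<eta> r)" for s
  have contu: "continuous_on {0..t} u"
    using u by (rule continuous_on_vector_derivative)
  then have cont: "continuous_on {0..t} (\<lambda>r. \<kappa> * norm (u r) + \<eta> r)"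
    by (intro continuous_intros \<eta>)
  have h': "(h has_real_derivative (\<kappa> * norm (u s) + \<eta> s)) (at s within {0..t})" if "s \<in> {0..t}" for s
    unfolding h_def has_real_derivative_iff_has_vector_derivative
    using integral_has_vector_derivative[OF cont that]
    by (auto intro!: derivative_eq_intros)
  have uh: "norm (u s) \<le> h s" if s: "s \<in> {0..t}" for s
  proof -
    have "norm (u s - u 0) \<le> h s - h 0"
    proof (rule norm_increment_le)
      show "(u has_vector_derivative u' r) (at r within {0..s})" if "r \<in> {0..s}" for r
        using u[of r] that s by (auto intro: has_vector_derivative_within_subset)
      show "(h has_real_derivative (\<kappa> * norm (u r) + \<eta> r)) (at r within {0..s})" if "r \<in> {0..s}" for r
        using h'[of r] that s by (auto intro: DERIV_subset)
      show "norm (u' r) \<le> \<kappa> * norm (u r) + \<eta> r" if "r \<in> {0..s}" for r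
        using le[of r] that s by auto
    qed (use s in auto)
    then show ?thesis
      using norm_triangle_sub[of "u s" "u 0"] by (simp add: h_def)
  qed
  have "((\<lambda>s. \<eta> s - exp (- (\<kappa> * s)) * (\<kappa> * norm (u s) + \<eta> s - \<kappa> * h s)) has_integral
     (integral {0..t} \<eta> - exp (- (\<kappa> * t)) * h t) - (integral {0..0} \<eta> - exp (- (\<kappa> * 0)) * h 0)) {0..t}"
  proof (rule fundamental_theorem_of_calculus[OF t])
    fix s assume s: "s \<in> {0..t}"
    have "((\<lambda>s. exp (- (\<kappa> * s)) * h s) has_real_derivative
        exp (- (\<kappa> * s)) * (\<kappa> * norm (u s) + \<eta> s - \<kappa> * h s)) (at s within {0..t})"
      by (auto intro!: derivative_eq_intros h'[OF s] simp: algebra_simps)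
    then show "((\<lambda>s. integral {0..s} \<eta> - exp (- (\<kappa> * s)) * h s) has_vector_derivative
        \<eta> s - exp (- (\<kappa> * s)) * (\<kappa> * norm (u s) + \<eta> s - \<kappa> * h s)) (at s within {0..t})"
      unfolding has_real_derivative_iff_has_vector_derivative
      by (intro has_vector_derivative_diff integral_has_vector_derivative[OF \<eta>(1) s])
  qed
  then have "0 \<le> (integral {0..t} \<eta> - exp (- (\<kappa> * t)) * h t) - (integral {0..0} \<eta> - exp (- (\<kappa> * 0)) * h 0)"
  proof (rule has_integral_nonneg)
    fix s assume s: "s \<in> {0..t}"
    have "\<kappa> * norm (u s) \<le> \<kappa> * h s"
      using uh[OF s] lam by (rule mult_left_mono)
    then have "exp (- (\<kappa> * s)) * (\<kappa> * norm (u s) + \<eta> s - \<kappa> * h s) \<le> exp (- (\<kappa> * s)) * \<eta> s"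
      by (intro mult_left_mono) auto
    also have "\<dots> \<le> \<eta> s"
      using \<eta>(2)[OF s] lam s by (intro mult_left_le_one_le) auto
    finally show "0 \<le> \<eta> s - exp (- (\<kappa> * s)) * (\<kappa> * norm (u s) + \<eta> s - \<kappa> * h s)" by simp
  qed
  then have "exp (- (\<kappa> * t)) * h t \<le> norm (u 0) + integral {0..t} \<eta>"
    by (simp add: h_def)
  then have "h t \<le> (norm (u 0) + integral {0..t} \<eta>) * exp (\<kappa> * t)"
    by (simp add: exp_minus field_simps)
  then show ?thesis
    using uh[of t] t by simp
qed

text \<open>
  Stated up to, but without, the end point: the limiting force is only defined on \<open>{0..<T}\<close>.
\<close>

lemma integral_has_vector_derivative_half_open:
  fixes f :: "real \<Rightarrow> 'a::euclidean_space"
  assumes f: "continuous_on {0..<T} f" and t: "t \<in> {0..<T}"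
  shows "((\<lambda>u. integral {0..u} f) has_vector_derivative f t) (at t within {0..<T})"
proof -
  define c where "c = (t + T) / 2"
  have "at t within {0..<T} = at t within {0..c}"
    by (rule at_within_nhd[of t "{..<c}"]) (use t in \<open>auto simp: c_def\<close>)
  moreover have "continuous_on {0..c} f"
    by (rule continuous_on_subset[OF f]) (use t in \<open>auto simp: c_def\<close>)
  moreover have "t \<in> {0..c}" using t by (auto simp: c_def)
  ultimately show ?thesis
    using integral_has_vector_derivative[of 0 c f t] by simp
qed

primrec picard :: "(real \<Rightarrow> 'a::euclidean_space \<Rightarrow> 'a) \<Rightarrow> 'a \<Rightarrow> nat \<Rightarrow> real \<Rightarrow> 'a" where
  "picard b z 0 = (\<lambda>t. z)"
| "picard b z (Suc n) = (\<lambda>t. z + integral {0..t} (\<lambda>s. b s (picard b z n s)))"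

text \<open>
  Successive Picard iterates differ by at most \<open>M * T * (1 / 2) ^ n * exp (2 * L * t)\<close>. The weight
  \<open>exp (2 * L * t)\<close> makes the Picard map a contraction by \<open>1 / 2\<close> on the whole of \<open>{0..<T}\<close>, so that no gluing of
  local solutions is necessary.
\<close>

lemma picard_lindelof:
  fixes b :: "real \<Rightarrow> 'a::euclidean_space \<Rightarrow> 'a"
  assumes T: "0 < T" and L: "0 < L"
    and cont: "continuous_on ({0..<T} \<times> UNIV) (\<lambda>(t, x). b t x)"
    and bd: "\<And>t x. t \<in> {0..<T} \<Longrightarrow> norm (b t x) \<le> M"
    and lip: "\<And>t x y. t \<in> {0..<T} \<Longrightarrow> norm (b t x - b t y) \<le> L * norm (x - y)"
  shows "\<exists>X. is_flow {0..<T} b X"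
proof -
  have "\<exists>Y. Y 0 = z \<and> (\<forall>t\<in>{0..<T}. (Y has_vector_derivative b t (Y t)) (at t within {0..<T}))" for z
  proof -
    define X where "X = picard b z"
    have X0: "X 0 = (\<lambda>t. z)" and XS: "X (Suc n) = (\<lambda>t. z + integral {0..t} (\<lambda>s. b s (X n s)))" for n
      by (simp_all add: X_def)
    have comp: "continuous_on {0..<T} (\<lambda>s. b s (u s))" if "continuous_on {0..<T} u" for u
    proof -
      have "continuous_on {0..<T} (\<lambda>s. (s, u s))"
        by (intro continuous_intros that)
      then show ?thesis
        using continuous_on_compose2[OF cont, of "{0..<T}" "\<lambda>s. (s, u s)"] by auto
    qed
    have int_cont: "continuous_on {0..<T} (\<lambda>t. z + integral {0..t} f)" if "continuous_on {0..<T} f"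
      for f :: "real \<Rightarrow> 'a"
      using integral_has_vector_derivative_half_open[OF that]
      by (intro continuous_intros) (rule continuous_on_vector_derivative)
    have contX: "continuous_on {0..<T} (X n)" for n
      by (induction n) (auto simp: X0 XS intro!: int_cont comp)
    have integrable: "(\<lambda>s. b s (u s)) integrable_on {0..t}" if "continuous_on {0..<T} u" "t < T" for u t
      by (rule integrable_continuous_real, rule continuous_on_subset[OF comp[OF that(1)]]) (use that in auto)
    have M: "0 \<le> M" using order_trans[OF norm_ge_zero bd[of 0 z]] T by simp
    have step: "norm (X (Suc n) t - X n t) \<le> M * T * (1 / 2) ^ n * exp (2 * L * t)" if "t \<in> {0..<T}" for n t
      using that
    proof (induction n arbitrary: t)
      case 0
      have "norm (integral {0..t} (\<lambda>s. b s z)) \<le> integral {0..t} (\<lambda>s. M)"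
        using 0 bd integrable[of "\<lambda>_. z" t]
        by (intro Henstock_Kurzweil_Integration.integral_norm_bound_integral) auto
      also have "\<dots> = M * t" using 0 by simp
      also have "\<dots> \<le> M * T * 1" using 0 M by (simp add: mult_left_mono)
      also have "\<dots> \<le> M * T * exp (2 * L * t)"
        using 0 M T L by (intro mult_left_mono) auto
      finally show ?case by (simp add: X0 XS)
    next
      case (Suc n)
      let ?A = "M * T * (1 / 2) ^ n"
      have G: "((\<lambda>s. L * (?A * exp (2 * L * s))) has_integral
          (?A * (1 / 2) * exp (2 * L * t) - ?A * (1 / 2) * exp (2 * L * 0))) {0..t}"
        using Suc.prems
        by (intro fundamental_theorem_of_calculus)
          (auto intro!: derivative_eq_intros simp: has_real_derivative_iff_has_vector_derivative[symmetric])
      have a: "X (Suc (Suc n)) t = z + integral {0..t} (\<lambda>s. b s (X (Suc n) s))"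
        by (simp only: XS[of "Suc n"])
      have a': "X (Suc n) t = z + integral {0..t} (\<lambda>s. b s (X n s))"
        by (simp only: XS[of n])
      have "X (Suc (Suc n)) t - X (Suc n) t =
          integral {0..t} (\<lambda>s. b s (X (Suc n) s)) - integral {0..t} (\<lambda>s. b s (X n s))"
        by (simp only: a a' add_diff_cancel_left)
      also have "\<dots> = integral {0..t} (\<lambda>s. b s (X (Suc n) s) - b s (X n s))"
        using integrable[OF contX] Suc.prems
        by (intro Henstock_Kurzweil_Integration.integral_diff[symmetric]) auto
      also have "norm \<dots> \<le> integral {0..t} (\<lambda>s. L * (?A * exp (2 * L * s)))"
      proof (rule Henstock_Kurzweil_Integration.integral_norm_bound_integral)
        show "(\<lambda>s. b s (X (Suc n) s) - b s (X n s)) integrable_on {0..t}"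
          using integrable[OF contX] Suc.prems by (intro Henstock_Kurzweil_Integration.integrable_diff) auto
        fix s assume s: "s \<in> {0..t}"
        have "norm (b s (X (Suc n) s) - b s (X n s)) \<le> L * norm (X (Suc n) s - X n s)"
          using s Suc.prems by (intro lip) auto
        also have "\<dots> \<le> L * (?A * exp (2 * L * s))"
          using s Suc.prems L by (intro mult_left_mono Suc.IH) auto
        finally show "norm (b s (X (Suc n) s) - b s (X n s)) \<le> L * (?A * exp (2 * L * s))" .
      qed (use G in auto)
      also have "\<dots> \<le> ?A * (1 / 2) * exp (2 * L * t)"
        unfolding integral_unique[OF G] using M T by simp
      finally show ?case by simp
    qed
    define Y where "Y t = z + (\<Sum>n. X (Suc n) t - X n t)" for t
    have "uniform_limit {0..<T} (\<lambda>n t. \<Sum>i<n. X (Suc i) t - X i t) (\<lambda>t. \<Sum>n. X (Suc n) t - X n t) sequentially"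
    proof (rule Weierstrass_m_test)
      show "norm (X (Suc n) t - X n t) \<le> M * T * exp (2 * L * T) * (1 / 2) ^ n" if "t \<in> {0..<T}" for n t
      proof -
        have "M * T * (1 / 2) ^ n * exp (2 * L * t) \<le> M * T * (1 / 2) ^ n * exp (2 * L * T)"
          using that M T L by (intro mult_left_mono) auto
        then show ?thesis using step[OF that, of n] by (simp add: mult_ac)
      qed
      show "summable (\<lambda>n. M * T * exp (2 * L * T) * (1 / 2) ^ n)"
        by (intro summable_mult summable_geometric) simp
    qed
    then have "uniform_limit {0..<T} (\<lambda>n t. z + (\<Sum>i<n. X (Suc i) t - X i t)) Y sequentially"
      unfolding Y_def by (intro uniform_limit_intros)
    moreover have "z + (\<Sum>i<n. X (Suc i) t - X i t) = X n t" for n t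
      by (subst sum_lessThan_telescope) (simp add: X0)
    ultimately have lim: "uniform_limit {0..<T} X Y sequentially" by simp
    then have contY: "continuous_on {0..<T} Y"
      by (rule uniform_limit_theorem[rotated]) (auto simp: contX)
    have limp: "(\<lambda>n. X n t) \<longlonglongrightarrow> Y t" if "t \<in> {0..<T}" for t
      using tendsto_uniform_limitI[OF lim that] .
    have YI: "Y t = z + integral {0..t} (\<lambda>s. b s (Y s))" if t: "t \<in> {0..<T}" for t
    proof -
      have "(\<lambda>n. integral {0..t} (\<lambda>s. b s (X n s))) \<longlonglongrightarrow> integral {0..t} (\<lambda>s. b s (Y s))"
      proof (rule dominated_convergence(2))
        show "(\<lambda>s. b s (X n s)) integrable_on {0..t}" for n
          using integrable[OF contX] t by simp
        show "norm (b s (X n s)) \<le> M" if "s \<in> {0..t}" for n s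
          using bd that t by auto
        show "(\<lambda>n. b s (X n s)) \<longlonglongrightarrow> b s (Y s)" if "s \<in> {0..t}" for s
        proof -
          have s: "s \<in> {0..<T}" using that t by auto
          have "continuous_on UNIV (b s)"
            using lip[OF s] L by (intro lipschitz_on_continuous_on lipschitz_onI) (auto simp: dist_norm)
          then show ?thesis
            using limp[OF s] by (intro continuous_on_tendsto_compose[of UNIV "b s"]) auto
        qed
      qed auto
      from tendsto_add[OF tendsto_const this] have "(\<lambda>n. X (Suc n) t) \<longlonglongrightarrow> z + integral {0..t} (\<lambda>s. b s (Y s))"
        by (simp add: XS)
      then show ?thesis
        using LIMSEQ_Suc[OF limp[OF t]] LIMSEQ_unique by blast
    qed
    have "Y 0 = z" using YI[of 0] T by simp
    moreover have "(Y has_vector_derivative b t (Y t)) (at t within {0..<T})" if t: "t \<in> {0..<T}" for t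
    proof (rule has_vector_derivative_transform[OF t])
      show "((\<lambda>t. z + integral {0..t} (\<lambda>s. b s (Y s))) has_vector_derivative b t (Y t)) (at t within {0..<T})"
        using has_vector_derivative_add[OF has_vector_derivative_const
            integral_has_vector_derivative_half_open[OF comp[OF contY] t]] by simp
    qed (rule YI)
    ultimately show ?thesis by blast
  qed
  then obtain Y where "\<And>z. Y z 0 = z \<and>
      (\<forall>t\<in>{0..<T}. (Y z has_vector_derivative b t (Y z t)) (at t within {0..<T}))"
    by metis
  then have "is_flow {0..<T} b (\<lambda>t z. Y z t)"
    unfolding is_flow_def by simp
  then show ?thesis by blast
qed

lemma is_flow_subset: "is_flow I b \<Phi> \<Longrightarrow> J \<subseteq> I \<Longrightarrow> is_flow J b \<Phi>"
  unfolding is_flow_def by (blast intro: has_vector_derivative_within_subset)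

lemma is_flow_D:
  assumes "is_flow I b \<Phi>"
  shows "\<Phi> 0 z = z"
    and "t \<in> I \<Longrightarrow> ((\<lambda>s. \<Phi> s z) has_vector_derivative b t (\<Phi> t z)) (at t within I)"
  using assms unfolding is_flow_def by auto

text \<open>
  Continuous dependence on the initial point; it serves to make flow maps Borel measurable, without
  which push-forwards would be meaningless.
\<close>

lemma is_flow_lipschitz:
  fixes \<Phi> :: "real \<Rightarrow> 'b::euclidean_space \<Rightarrow> 'b"
  assumes flow: "is_flow {0..t} b \<Phi>" and t: "0 \<le> t" and L: "0 \<le> \<kappa>"
    and lip: "\<And>s x y. s \<in> {0..t} \<Longrightarrow> norm (b s x - b s y) \<le> \<kappa> * norm (x - y)"
  shows "norm (\<Phi> t x - \<Phi> t y) \<le> exp (\<kappa> * t) * norm (x - y)"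
proof -
  have "norm (\<Phi> t x - \<Phi> t y) \<le> (norm (\<Phi> 0 x - \<Phi> 0 y) + integral {0..t} (\<lambda>_. 0)) * exp (\<kappa> * t)"
    using lip
    by (intro gronwall[where u' = "\<lambda>s. b s (\<Phi> s x) - b s (\<Phi> s y)"] t L
      has_vector_derivative_diff is_flow_D(2)[OF flow]) auto
  then show ?thesis
    by (simp add: is_flow_D(1)[OF flow] mult.commute)
qed

lemma is_flow_continuous:
  fixes \<Phi> :: "real \<Rightarrow> 'b::euclidean_space \<Rightarrow> 'b"
  assumes "is_flow {0..t} b \<Phi>" "0 \<le> t" "0 \<le> \<kappa>"
    and "\<And>s x y. s \<in> {0..t} \<Longrightarrow> norm (b s x - b s y) \<le> \<kappa> * norm (x - y)"
  shows "continuous_on UNIV (\<Phi> t)"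
proof -
  have "(exp (\<kappa> * t))-lipschitz_on UNIV (\<Phi> t)"
    using is_flow_lipschitz[OF assms] by (intro lipschitz_onI) (auto simp: dist_norm)
  then show ?thesis by (rule lipschitz_on_continuous_on)
qed

section \<open>The mean-field force\<close>

locale bounded_lipschitz_kernel =
  fixes G :: "'a::euclidean_space \<Rightarrow> 'a" and M L :: real
  assumes M: "0 < M" and L: "0 < L"
    and bounded: "norm (G x) \<le> M"
    and lipschitz: "norm (G x - G y) \<le> L * norm (x - y)"
begin

lemma kernel_measurable: "G \<in> borel_measurable borel"
proof -
  have "L-lipschitz_on UNIV G"
    using lipschitz L by (intro lipschitz_onI) (auto simp: dist_norm)
  then show ?thesis
    by (intro borel_measurable_continuous_onI lipschitz_on_continuous_on)
qed

lemma kernel_integrable: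
  assumes "prob_space \<mu>" "h \<in> borel_measurable \<mu>"
  shows "integrable \<mu> (\<lambda>y. G (x - h y))"
proof -
  interpret prob_space \<mu> by fact
  note [measurable] = assms(2) kernel_measurable
  show ?thesis
    using bounded by (intro integrable_const_bound[of _ M]) auto
qed

lemma P1_kernel_integrable: "\<mu> \<in> P1 \<Longrightarrow> integrable \<mu> (\<lambda>y. G (x - y))"
  using P1_D[of \<mu>] by (intro kernel_integrable) (auto cong: measurable_cong_sets)

lemma norm_convol_le:
  assumes "\<mu> \<in> P1"
  shows "norm (convol G \<mu> x) \<le> M"
proof -
  interpret prob_space \<mu> using P1_D[OF assms] by simp
  have "norm (convol G \<mu> x) \<le> (LINT y|\<mu>. norm (G (x - y)))"
    unfolding convol_def by (rule integral_norm_bound)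
  also have "\<dots> \<le> (LINT y|\<mu>. M)"
    using P1_kernel_integrable[OF assms] bounded by (intro integral_mono) auto
  finally show ?thesis by (simp add: prob_space)
qed

lemma norm_convol_diff_le:
  assumes "\<mu> \<in> P1"
  shows "norm (convol G \<mu> x - convol G \<mu> y) \<le> L * norm (x - y)"
proof -
  interpret prob_space \<mu> using P1_D[OF assms] by simp
  have "convol G \<mu> x - convol G \<mu> y = (LINT w|\<mu>. G (x - w) - G (y - w))"
    unfolding convol_def using P1_kernel_integrable[OF assms] by simp
  also have "norm \<dots> \<le> (LINT w|\<mu>. norm (G (x - w) - G (y - w)))"
    by (rule integral_norm_bound)
  also have "\<dots> \<le> (LINT w|\<mu>. L * norm (x - y))"
  proof (rule integral_mono)
    show "norm (G (x - w) - G (y - w)) \<le> L * norm (x - y)" for w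
      using lipschitz[of "x - w" "y - w"] by simp
  qed (use P1_kernel_integrable[OF assms] in auto)
  finally show ?thesis by (simp add: prob_space)
qed

text \<open>
  The integrand \<open>y \<mapsto> G (x - y)\<close> is an admissible test function for \<open>W\<^sub>1\<close> convergence.
\<close>

lemma convol_tendsto:
  assumes "\<forall>\<^sub>F i in F. \<mu> i \<in> P1" "\<nu> \<in> P1" "((\<lambda>i. W1 (\<mu> i) \<nu>) \<longlongrightarrow> 0) F"
  shows "((\<lambda>i. convol G (\<mu> i) x) \<longlongrightarrow> convol G \<nu> x) F"
  unfolding convol_def
proof (rule W1_tendsto_imp_integral_tendsto[OF assms(1,2) _ _ _ assms(3)])
  show "norm (G (x - y) - G (x - w)) \<le> L * norm (y - w)" for y w
    using lipschitz[of "x - y" "x - w"] by (simp add: norm_minus_commute)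
qed (use bounded L in auto)

lemma norm_force_le: "\<rho> t \<in> P1 \<Longrightarrow> norm (force G \<rho> t x) \<le> M"
  by (simp add: force_def norm_convol_le)

lemma norm_force_diff_le:
  "\<rho> t \<in> P1 \<Longrightarrow> norm (force G \<rho> t x - force G \<rho> t y) \<le> L * norm (x - y)"
  using norm_convol_diff_le[of "\<rho> t" y x] by (simp add: force_def norm_minus_commute)

lemma continuous_on_force:
  assumes "P1_curve I \<rho>"
  shows "continuous_on (I \<times> UNIV) (\<lambda>(t, x). force G \<rho> t x)"
proof (rule continuous_on_TimesI)
  have P1: "\<rho> t \<in> P1" if "t \<in> I" for t
    using assms that unfolding P1_curve_def by blast
  have "L-lipschitz_on X (force G \<rho> t)" if "t \<in> I" for t X
    using norm_force_diff_le[of \<rho> t, OF P1[OF that]] L by (intro lipschitz_onI) (auto simp: dist_norm)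
  then show "local_lipschitz I UNIV (force G \<rho>)"
    by (intro local_lipschitzI) (auto intro!: exI[of _ 1] exI[of _ L] simp: L)
  show "continuous_on I (\<lambda>t. force G \<rho> t x)" for x
    unfolding continuous_on_def force_def
  proof (intro ballI tendsto_minus convol_tendsto)
    fix t assume "t \<in> I"
    then show "\<rho> t \<in> P1" "((\<lambda>s. W1 (\<rho> s) (\<rho> t)) \<longlongrightarrow> 0) (at t within I)"
      using assms unfolding P1_curve_def by auto
    show "\<forall>\<^sub>F s in at t within I. \<rho> s \<in> P1"
      using P1 by (auto simp: eventually_at_filter)
  qed
qed

end

section \<open>Trajectories of the kinetic equation\<close>

text \<open>
  The estimates on single trajectories, for a force that need not come from a kernel. The constants \<open>M\<close> and \<open>L\<close> are
  independent of \<open>\<epsilon>\<close>.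
\<close>

locale kinetic_flow =
  fixes \<epsilon> M L T :: real and E :: "real \<Rightarrow> 'a::euclidean_space \<Rightarrow> 'a"
    and \<Phi> :: "real \<Rightarrow> 'a \<times> 'a \<Rightarrow> 'a \<times> 'a"
  assumes eps: "0 < \<epsilon>" and M: "0 < M" and L: "0 < L"
    and E_bounded: "t \<in> {0..T} \<Longrightarrow> norm (E t x) \<le> M"
    and E_lipschitz: "t \<in> {0..T} \<Longrightarrow> norm (E t x - E t y) \<le> L * norm (x - y)"
    and E_continuous: "continuous_on ({0..T} \<times> UNIV) (\<lambda>(t, x). E t x)"
    and flow: "is_flow {0..T} (kinetic_field \<epsilon> E) \<Phi>"
begin

lemma flow_0: "\<Phi> 0 z = z"
  by (rule is_flow_D[OF flow])

lemma position_derivative: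
  assumes "t \<in> {0..T}" "S \<subseteq> {0..T}"
  shows "((\<lambda>s. fst (\<Phi> s z)) has_vector_derivative snd (\<Phi> t z)) (at t within S)"
proof -
  have "((\<lambda>s. \<Phi> s z) has_vector_derivative kinetic_field \<epsilon> E t (\<Phi> t z)) (at t within S)"
    by (rule has_vector_derivative_within_subset[OF is_flow_D(2)[OF flow assms(1)] assms(2)])
  from bounded_linear.has_vector_derivative[OF bounded_linear_fst this]
  show ?thesis by (simp add: kinetic_field_def case_prod_beta)
qed

lemma velocity_derivative:
  assumes "t \<in> {0..T}" "S \<subseteq> {0..T}"
  shows "((\<lambda>s. snd (\<Phi> s z)) has_vector_derivative
      (1 / \<epsilon>) *\<^sub>R (E t (fst (\<Phi> t z)) - snd (\<Phi> t z))) (at t within S)"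
proof -
  have "((\<lambda>s. \<Phi> s z) has_vector_derivative kinetic_field \<epsilon> E t (\<Phi> t z)) (at t within S)"
    by (rule has_vector_derivative_within_subset[OF is_flow_D(2)[OF flow assms(1)] assms(2)])
  from bounded_linear.has_vector_derivative[OF bounded_linear_snd this]
  show ?thesis by (simp add: kinetic_field_def case_prod_beta algebra_simps)
qed

text \<open>
  Multiplying by the integrating factor removes the friction term. The lemma is used with \<open>a = 0\<close> to bound the
  velocity and with \<open>a\<close> the terminal force to show that the velocity approaches it.
\<close>

lemma relaxation_derivative:
  assumes "s \<in> {0..T}" "S \<subseteq> {0..T}"
  shows "((\<lambda>s. exp ((s - t) / \<epsilon>) *\<^sub>R (snd (\<Phi> s z) - a)) has_vector_derivative
      (exp ((s - t) / \<epsilon>) / \<epsilon>) *\<^sub>R (E s (fst (\<Phi> s z)) - a)) (at s within S)"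
proof -
  have "((\<lambda>s. exp ((s - t) / \<epsilon>)) has_real_derivative exp ((s - t) / \<epsilon>) / \<epsilon>) (at s within S)"
    using eps by (auto intro!: derivative_eq_intros)
  from has_vector_derivative_scaleR[OF this
      has_vector_derivative_diff[OF velocity_derivative[OF assms] has_vector_derivative_const]]
  show ?thesis
    by (simp add: scaleR_add_right[symmetric] del: scaleR_add_right)
qed

text \<open>
  The velocity is a convex combination of its initial value and of forces, which are bounded by \<open>M\<close>.
\<close>

lemma velocity_bound:
  assumes t: "t \<in> {0..T}"
  shows "norm (snd (\<Phi> t z)) \<le> norm (snd z) + M"
proof -
  have "norm (exp ((t - t) / \<epsilon>) *\<^sub>R (snd (\<Phi> t z) - 0) - exp ((0 - t) / \<epsilon>) *\<^sub>R (snd (\<Phi> 0 z) - 0))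
      \<le> M * exp ((t - t) / \<epsilon>) - M * exp ((0 - t) / \<epsilon>)"
  proof (rule norm_increment_le)
    fix s assume s: "s \<in> {0..t}"
    show "((\<lambda>s. exp ((s - t) / \<epsilon>) *\<^sub>R (snd (\<Phi> s z) - 0)) has_vector_derivative
      (exp ((s - t) / \<epsilon>) / \<epsilon>) *\<^sub>R (E s (fst (\<Phi> s z)) - 0)) (at s within {0..t})"
      by (rule relaxation_derivative) (use s t in auto)
    show "((\<lambda>s. M * exp ((s - t) / \<epsilon>)) has_real_derivative M * (exp ((s - t) / \<epsilon>) / \<epsilon>)) (at s within {0..t})"
      using eps by (auto intro!: derivative_eq_intros)
    show "norm ((exp ((s - t) / \<epsilon>) / \<epsilon>) *\<^sub>R (E s (fst (\<Phi> s z)) - 0)) \<le> M * (exp ((s - t) / \<epsilon>) / \<epsilon>)"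
      using E_bounded[of s] s t eps by (simp add: mult.commute mult_right_mono divide_right_mono)
  qed (use t in auto)
  also have "\<dots> \<le> M" using M by simp
  finally have "norm (snd (\<Phi> t z)) \<le> norm (exp ((0 - t) / \<epsilon>) *\<^sub>R snd z) + M"
    using norm_triangle_sub[of "snd (\<Phi> t z)" "exp ((0 - t) / \<epsilon>) *\<^sub>R snd z"] by (simp add: flow_0)
  moreover have "norm (exp ((0 - t) / \<epsilon>) *\<^sub>R snd z) \<le> norm (snd z)"
    using t eps by (auto intro!: mult_left_le_one_le simp: divide_nonpos_pos)
  ultimately show ?thesis by simp
qed

lemma position_lipschitz_in_time:
  assumes "0 \<le> s" "s \<le> t" "t \<le> T"
  shows "norm (fst (\<Phi> t z) - fst (\<Phi> s z)) \<le> (norm (snd z) + M) * (t - s)"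
proof -
  have "norm (fst (\<Phi> t z) - fst (\<Phi> s z)) \<le> (norm (snd z) + M) * t - (norm (snd z) + M) * s"
  proof (rule norm_increment_le[OF assms(2)])
    fix r assume r: "r \<in> {s..t}"
    show "((\<lambda>s. fst (\<Phi> s z)) has_vector_derivative snd (\<Phi> r z)) (at r within {s..t})"
      by (rule position_derivative) (use r assms in auto)
    show "norm (snd (\<Phi> r z)) \<le> norm (snd z) + M"
      by (rule velocity_bound) (use r assms in auto)
  qed (auto intro!: derivative_eq_intros)
  then show ?thesis by (simp add: right_diff_distrib)
qed

lemma flow_continuous:
  assumes "t \<in> {0..T}"
  shows "continuous_on UNIV (\<Phi> t)"
proof (rule is_flow_continuous)
  show "is_flow {0..t} (kinetic_field \<epsilon> E) \<Phi>"
    by (rule is_flow_subset[OF flow]) (use assms in auto)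
  show "0 \<le> t" using assms by simp
  show "0 \<le> 1 + (1 / \<epsilon>) + (1 / \<epsilon>) * L" using eps L by simp
  fix s :: real and p q :: "'a \<times> 'a" assume s: "s \<in> {0..t}"
  obtain x v y w where pq: "p = (x, v)" "q = (y, w)" by (cases p, cases q) blast
  have xy: "norm (x - y) \<le> norm (p - q)" "norm (v - w) \<le> norm (p - q)"
    using norm_fst_le[of "x - y" "v - w"] norm_snd_le[of "v - w" "x - y"] by (simp_all add: pq)
  have "kinetic_field \<epsilon> E s p - kinetic_field \<epsilon> E s q =
      (v - w, (1 / \<epsilon>) *\<^sub>R (E s x - E s y) - (1 / \<epsilon>) *\<^sub>R (v - w))"
    by (simp add: pq kinetic_field_def algebra_simps)
  then have "norm (kinetic_field \<epsilon> E s p - kinetic_field \<epsilon> E s q) \<le>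
      norm (v - w) + norm ((1 / \<epsilon>) *\<^sub>R (E s x - E s y) - (1 / \<epsilon>) *\<^sub>R (v - w))"
    using norm_Pair_le by metis
  also have "\<dots> \<le> norm (v - w) + ((1 / \<epsilon>) * norm (E s x - E s y) + (1 / \<epsilon>) * norm (v - w))"
    using eps by (intro add_left_mono order_trans[OF norm_triangle_ineq4]) simp
  also have "\<dots> \<le> norm (p - q) + ((1 / \<epsilon>) * (L * norm (p - q)) + (1 / \<epsilon>) * norm (p - q))"
  proof -
    have "norm (E s x - E s y) \<le> L * norm (x - y)"
      by (rule E_lipschitz) (use s assms in auto)
    also have "\<dots> \<le> L * norm (p - q)" using xy L by simp
    finally show ?thesis
      using xy eps by (intro add_mono mult_left_mono) auto
  qed
  also have "\<dots> = (1 + (1 / \<epsilon>) + (1 / \<epsilon>) * L) * norm (p - q)"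
    by (simp add: algebra_simps)
  finally show "norm (kinetic_field \<epsilon> E s p - kinetic_field \<epsilon> E s q)
      \<le> (1 + (1 / \<epsilon>) + (1 / \<epsilon>) * L) * norm (p - q)" .
qed

text \<open>
  The velocity is an average of past forces with the weight \<open>exp ((s - t) / \<epsilon>) / \<epsilon>\<close>, which concentrates
  at the present time \<open>t\<close>. A force that varies at the rate \<open>C\<close> contributes \<open>C * \<epsilon>\<close>, the mean age under this weight being
  at most \<open>\<epsilon>\<close>; the first summand is the memory of the initial velocity.
\<close>

lemma velocity_relaxation:
  assumes t: "t \<in> {0..T}" and C: "0 \<le> C"
    and lip: "\<And>s. s \<in> {0..t} \<Longrightarrow> norm (E s (fst (\<Phi> s z)) - E t (fst (\<Phi> t z))) \<le> C * (t - s)"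
  shows "norm (snd (\<Phi> t z) - E t (fst (\<Phi> t z))) \<le> exp (- (t / \<epsilon>)) * (norm (snd z) + M) + C * \<epsilon>"
proof -
  define a where "a = E t (fst (\<Phi> t z))"
  have "norm (exp ((t - t) / \<epsilon>) *\<^sub>R (snd (\<Phi> t z) - a) - exp ((0 - t) / \<epsilon>) *\<^sub>R (snd (\<Phi> 0 z) - a))
      \<le> C * (exp ((t - t) / \<epsilon>) * (t - t + \<epsilon>)) - C * (exp ((0 - t) / \<epsilon>) * (t - 0 + \<epsilon>))"
  proof (rule norm_increment_le)
    fix s assume s: "s \<in> {0..t}"
    show "((\<lambda>s. exp ((s - t) / \<epsilon>) *\<^sub>R (snd (\<Phi> s z) - a)) has_vector_derivative
      (exp ((s - t) / \<epsilon>) / \<epsilon>) *\<^sub>R (E s (fst (\<Phi> s z)) - a)) (at s within {0..t})"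
      by (rule relaxation_derivative) (use s t in auto)
    \<comment> \<open>An explicit primitive of the weight times \<open>C * (t - s)\<close>.\<close>
    show "((\<lambda>s. C * (exp ((s - t) / \<epsilon>) * (t - s + \<epsilon>))) has_real_derivative
        (exp ((s - t) / \<epsilon>) / \<epsilon>) * (C * (t - s))) (at s within {0..t})"
      using eps by (auto intro!: derivative_eq_intros simp: field_simps)
    show "norm ((exp ((s - t) / \<epsilon>) / \<epsilon>) *\<^sub>R (E s (fst (\<Phi> s z)) - a)) \<le> (exp ((s - t) / \<epsilon>) / \<epsilon>) * (C * (t - s))"
      using lip[OF s] eps unfolding a_def norm_scaleR by (simp add: divide_right_mono mult_left_mono)
  qed (use t in auto)
  also have "\<dots> \<le> C * \<epsilon>"
    using t eps C by simp
  finally have "norm (snd (\<Phi> t z) - a) \<le> norm (exp (- (t / \<epsilon>)) *\<^sub>R (snd z - a)) + C * \<epsilon>"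
    using norm_triangle_sub[of "snd (\<Phi> t z) - a" "exp (- (t / \<epsilon>)) *\<^sub>R (snd z - a)"] by (simp add: flow_0)
  moreover have "norm (snd z - a) \<le> norm (snd z) + M"
    using norm_triangle_ineq4[of "snd z" a] E_bounded[OF t, of "fst (\<Phi> t z)"] by (simp add: a_def)
  ultimately show ?thesis
    unfolding a_def[symmetric] by (simp add: mult_left_mono order_trans)
qed

text \<open>
  The point \<open>u = x + \<epsilon> v - X\<close> satisfies \<open>u' = E(t, x) - F(t, X)\<close>, without any factor \<open>1 / \<epsilon>\<close>. The right-hand side is
  compared through \<open>E(t, X)\<close>, so that the difference of the two forces is only needed along the limiting trajectory.
\<close>

lemma position_error:
  fixes F :: "real \<Rightarrow> 'a \<Rightarrow> 'a"
  assumes t: "t \<in> {0..T}"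
    and F: "continuous_on ({0..t} \<times> UNIV) (\<lambda>(s, x). F s x)"
    and X: "X 0 = fst z" "\<And>s. s \<in> {0..t} \<Longrightarrow> (X has_vector_derivative F s (X s)) (at s within {0..t})"
  shows "norm (fst (\<Phi> t z) - X t) \<le> \<epsilon> * (norm (snd z) + M) +
    (\<epsilon> * norm (snd z) + (L * \<epsilon> * (norm (snd z) + M) * t +
      integral {0..t} (\<lambda>s. norm (E s (X s) - F s (X s))))) * exp (L * t)"
proof -
  define B where "B = norm (snd z) + M"
  define u where "u s = fst (\<Phi> s z) + \<epsilon> *\<^sub>R snd (\<Phi> s z) - X s" for s
  have contX: "continuous_on {0..t} X"
    using X(2) by (rule continuous_on_vector_derivative)
  have pair: "continuous_on {0..t} (\<lambda>s. (s, X s))"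
    by (intro continuous_intros contX)
  have "continuous_on {0..t} (\<lambda>s. E s (X s))" "continuous_on {0..t} (\<lambda>s. F s (X s))"
    using continuous_on_compose2[OF E_continuous pair] continuous_on_compose2[OF F pair] t by (simp_all add: image_subset_iff)
  then have cont: "continuous_on {0..t} (\<lambda>s. norm (E s (X s) - F s (X s)))"
    by (intro continuous_intros)
  have "norm (u t) \<le> (norm (u 0) + integral {0..t} (\<lambda>s. L * \<epsilon> * B + norm (E s (X s) - F s (X s)))) * exp (L * t)"
  proof (rule gronwall)
    fix s assume s: "s \<in> {0..t}"
    have vb: "norm (snd (\<Phi> s z)) \<le> B"
      unfolding B_def by (rule velocity_bound) (use s t in auto)
    have "(u has_vector_derivative snd (\<Phi> s z) + \<epsilon> *\<^sub>R ((1 / \<epsilon>) *\<^sub>R (E s (fst (\<Phi> s z)) - snd (\<Phi> s z)))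
        - F s (X s)) (at s within {0..t})"
      unfolding u_def
    proof (intro has_vector_derivative_diff has_vector_derivative_add X(2)[OF s])
      show "((\<lambda>s. fst (\<Phi> s z)) has_vector_derivative snd (\<Phi> s z)) (at s within {0..t})"
        by (rule position_derivative) (use s t in auto)
      show "((\<lambda>s. \<epsilon> *\<^sub>R snd (\<Phi> s z)) has_vector_derivative
          \<epsilon> *\<^sub>R ((1 / \<epsilon>) *\<^sub>R (E s (fst (\<Phi> s z)) - snd (\<Phi> s z)))) (at s within {0..t})"
        by (intro bounded_linear.has_vector_derivative[OF bounded_linear_scaleR_right]
            velocity_derivative) (use s t in auto)
    qed
    then show "(u has_vector_derivative E s (fst (\<Phi> s z)) - F s (X s)) (at s within {0..t})"
      using eps by simp
    have "fst (\<Phi> s z) - X s = u s - \<epsilon> *\<^sub>R snd (\<Phi> s z)"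
      by (simp add: u_def)
    then have "norm (fst (\<Phi> s z) - X s) \<le> norm (u s) + \<epsilon> * norm (snd (\<Phi> s z))"
      using norm_triangle_ineq4[of "u s" "\<epsilon> *\<^sub>R snd (\<Phi> s z)"] eps by simp
    also have "\<dots> \<le> norm (u s) + \<epsilon> * B"
      using vb eps by simp
    finally have "L * norm (fst (\<Phi> s z) - X s) \<le> L * (norm (u s) + \<epsilon> * B)"
      using L by simp
    moreover have "norm (E s (fst (\<Phi> s z)) - E s (X s)) \<le> L * norm (fst (\<Phi> s z) - X s)"
      by (rule E_lipschitz) (use s t in auto)
    ultimately show "norm (E s (fst (\<Phi> s z)) - F s (X s)) \<le>
        L * norm (u s) + (L * \<epsilon> * B + norm (E s (X s) - F s (X s)))"
      using norm_triangle_ineq[of "E s (fst (\<Phi> s z)) - E s (X s)" "E s (X s) - F s (X s)"]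
      by (simp add: algebra_simps)
    show "0 \<le> L * \<epsilon> * B + norm (E s (X s) - F s (X s))"
      using L eps M by (simp add: B_def)
  qed (use t L cont in \<open>auto intro!: continuous_intros\<close>)
  also have "integral {0..t} (\<lambda>s. L * \<epsilon> * B + norm (E s (X s) - F s (X s))) =
      L * \<epsilon> * B * t + integral {0..t} (\<lambda>s. norm (E s (X s) - F s (X s)))"
    using t integrable_continuous_real[OF cont]
    by (subst Henstock_Kurzweil_Integration.integral_add) auto
  also have "norm (u 0) = \<epsilon> * norm (snd z)"
    using eps by (simp add: u_def flow_0 X)
  finally have *: "norm (u t) \<le> (\<epsilon> * norm (snd z) + (L * \<epsilon> * B * t +
      integral {0..t} (\<lambda>s. norm (E s (X s) - F s (X s))))) * exp (L * t)" .
  have "norm (fst (\<Phi> t z) - X t) \<le> norm (u t) + norm (\<epsilon> *\<^sub>R snd (\<Phi> t z))"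
    using norm_triangle_ineq4[of "u t" "\<epsilon> *\<^sub>R snd (\<Phi> t z)"] by (simp add: u_def)
  also have "norm (\<epsilon> *\<^sub>R snd (\<Phi> t z)) \<le> \<epsilon> * B"
    using velocity_bound[OF t, of z] eps by (simp add: B_def)
  finally show ?thesis
    using * unfolding B_def by linarith
qed

end

section \<open>The small inertia limit\<close>

lemma P1_first_marginal: "f \<in> P1 \<Longrightarrow> first_marginal f \<in> P1"
  unfolding first_marginal_def
  by (rule P1_distr[where A = 0 and B = 1])
    (auto intro!: continuous_intros simp: norm_fst_le)

lemma first_marginal_distr:
  assumes "f0 \<in> P1" "continuous_on UNIV F"
  shows "first_marginal (distr f0 borel F) = distr f0 borel (\<lambda>z. fst (F z))"
proof -
  have "F \<in> measurable f0 borel"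
    using P1_D(2)[OF assms(1)] assms(2) by (simp add: borel_measurable_continuous_onI cong: measurable_cong_sets)
  then show ?thesis
    unfolding first_marginal_def by (simp add: distr_distr borel_measurable_fst_snd comp_def)
qed

context bounded_lipschitz_kernel
begin

lemma kinetic_solution_flow:
  assumes sol: "kinetic_solution G \<epsilon> f0 f" and "0 < \<epsilon>" "0 < T"
  obtains \<Phi> where "kinetic_flow \<epsilon> M L T (force G (\<lambda>t. first_marginal (f t))) \<Phi>"
    and "\<And>t. t \<in> {0..T} \<Longrightarrow> f t = distr f0 borel (\<Phi> t)"
proof -
  have "kinetic_solution_on T G \<epsilon> f0 f"
    using sol assms(3) unfolding kinetic_solution_def by blast
  then obtain \<Phi> where P1: "\<forall>t\<in>{0..T}. f t \<in> P1"
    and adm: "admissible_field T (force G (\<lambda>t. first_marginal (f t)))"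
    and flow: "is_flow {0..T} (kinetic_field \<epsilon> (force G (\<lambda>t. first_marginal (f t)))) \<Phi>"
    and f: "\<forall>t\<in>{0..T}. f t = distr f0 borel (\<Phi> t)"
    unfolding kinetic_solution_on_def by blast
  have "first_marginal (f t) \<in> P1" if "t \<in> {0..T}" for t
    using P1 that P1_first_marginal by blast
  then have "kinetic_flow \<epsilon> M L T (force G (\<lambda>t. first_marginal (f t))) \<Phi>"
    using assms M L adm flow
    by unfold_locales (auto intro!: norm_force_le norm_force_diff_le simp: admissible_field_def)
  then show ?thesis using f that by blast
qed

text \<open>
  The force at \<open>x\<close> is the \<open>f0\<close>-average of \<open>- G (x - x(t; z))\<close>, and the particle that starts at \<open>z\<close> moves with speed at most
  \<open>norm z + M\<close>, so that the finite first moment of \<open>f0\<close> yields a rate independent of \<open>\<epsilon>\<close>.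
\<close>

lemma force_lipschitz_in_time:
  assumes f0: "f0 \<in> P1" and flow: "kinetic_flow \<epsilon> M L T (force G (\<lambda>t. first_marginal (f t))) \<Phi>"
    and f: "\<And>t. t \<in> {0..T} \<Longrightarrow> f t = distr f0 borel (\<Phi> t)"
    and st: "0 \<le> s" "s \<le> t" "t \<le> T"
  shows "norm (force G (\<lambda>t. first_marginal (f t)) s x - force G (\<lambda>t. first_marginal (f t)) t x)
    \<le> L * ((LINT z|f0. norm z) + M) * (t - s)"
proof -
  interpret kinetic_flow \<epsilon> M L T "force G (\<lambda>t. first_marginal (f t))" \<Phi> by (rule flow)
  note f0' = P1_D[OF f0]
  interpret prob_space f0 by (rule f0')
  have m: "(\<lambda>z. fst (\<Phi> r z)) \<in> borel_measurable f0" if "r \<in> {0..T}" for r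
    using flow_continuous[OF that] f0'(2)
    by (simp add: borel_measurable_continuous_onI continuous_on_fst cong: measurable_cong_sets)
  have rep: "force G (\<lambda>t. first_marginal (f t)) r x = - (LINT z|f0. G (x - fst (\<Phi> r z)))"
    if r: "r \<in> {0..T}" for r
  proof -
    have "(\<lambda>y. G (x - y)) \<in> borel_measurable borel"
      using kernel_measurable by measurable
    then show ?thesis
      unfolding force_def convol_def f[OF r] first_marginal_distr[OF f0 flow_continuous[OF r]]
      using m[OF r] by (simp add: integral_distr)
  qed
  have int: "integrable f0 (\<lambda>z. G (x - fst (\<Phi> r z)))" if "r \<in> {0..T}" for r
    by (rule kernel_integrable[OF f0'(1) m[OF that]])
  have s: "s \<in> {0..T}" and t: "t \<in> {0..T}" using st by auto
  have "force G (\<lambda>t. first_marginal (f t)) s x - force G (\<lambda>t. first_marginal (f t)) t x =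
      (LINT z|f0. G (x - fst (\<Phi> t z)) - G (x - fst (\<Phi> s z)))"
    unfolding rep[OF s] rep[OF t] using int[OF s] int[OF t] by simp
  also have "norm \<dots> \<le> (LINT z|f0. norm (G (x - fst (\<Phi> t z)) - G (x - fst (\<Phi> s z))))"
    by (rule integral_norm_bound)
  also have "\<dots> \<le> (LINT z|f0. L * ((norm z + M) * (t - s)))"
  proof (rule integral_mono)
    show "norm (G (x - fst (\<Phi> t z)) - G (x - fst (\<Phi> s z))) \<le> L * ((norm z + M) * (t - s))" for z
    proof -
      have "norm (G (x - fst (\<Phi> t z)) - G (x - fst (\<Phi> s z))) \<le> L * norm (fst (\<Phi> t z) - fst (\<Phi> s z))"
        using lipschitz[of "x - fst (\<Phi> t z)" "x - fst (\<Phi> s z)"] by (simp add: norm_minus_commute)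
      also have "\<dots> \<le> L * ((norm (snd z) + M) * (t - s))"
        using position_lipschitz_in_time[OF st] L by (intro mult_left_mono) auto
      also have "\<dots> \<le> L * ((norm z + M) * (t - s))"
        using norm_snd_le[of "snd z" "fst z"] st L by (intro mult_left_mono mult_right_mono) auto
      finally show ?thesis .
    qed
  qed (use int[OF s] int[OF t] f0'(4) in auto)
  also have "\<dots> = L * ((LINT z|f0. norm z) + M) * (t - s)"
    using f0'(4) by (simp add: prob_space)
  finally show ?thesis .
qed

text \<open>
  The limit of the kinetic flow maps. The velocity at \<open>t = 0\<close> is the initial one, since the initial layer of width
  \<open>\<epsilon>\<close> has collapsed to this single time.
\<close>

definition limit_map :: "(real \<Rightarrow> 'a measure) \<Rightarrow> (real \<Rightarrow> 'a \<Rightarrow> 'a) \<Rightarrow> real \<Rightarrow> 'a \<times> 'a \<Rightarrow> 'a \<times> 'a" where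
  "limit_map \<rho> X t z = (X t (fst z), if t = 0 then snd z else force G \<rho> t (X t (fst z)))"

lemma flow_displacement:
  assumes "P1_curve {0..<T} \<rho>" and flow: "is_flow {0..<T} (force G \<rho>) X" and t: "t \<in> {0..<T}"
  shows "norm (X t x - x) \<le> M * t"
proof -
  have "norm (X t x - X 0 x) \<le> M * t - M * 0"
  proof (rule norm_increment_le)
    fix s assume s: "s \<in> {0..t}"
    show "((\<lambda>s. X s x) has_vector_derivative force G \<rho> s (X s x)) (at s within {0..t})"
      by (rule has_vector_derivative_within_subset[OF is_flow_D(2)[OF flow]]) (use s t in auto)
    show "norm (force G \<rho> s (X s x)) \<le> M"
      using assms(1) s t by (intro norm_force_le) (auto simp: P1_curve_def)
  qed (use t in \<open>auto intro!: derivative_eq_intros\<close>)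
  then show ?thesis by (simp add: is_flow_D(1)[OF flow])
qed

lemma continuous_on_flow:
  assumes "P1_curve {0..<T} \<rho>" and flow: "is_flow {0..<T} (force G \<rho>) X" and t: "t \<in> {0..<T}"
  shows "continuous_on UNIV (X t)"
proof (rule is_flow_continuous)
  show "is_flow {0..t} (force G \<rho>) X"
    by (rule is_flow_subset[OF flow]) (use t in auto)
  show "norm (force G \<rho> s x - force G \<rho> s y) \<le> L * norm (x - y)" if "s \<in> {0..t}" for s x y
    using assms(1) that t by (intro norm_force_diff_le) (auto simp: P1_curve_def)
qed (use t L in auto)

lemma continuous_on_limit_map:
  assumes "P1_curve {0..<T} \<rho>" and flow: "is_flow {0..<T} (force G \<rho>) X" and t: "t \<in> {0..<T}"
  shows "continuous_on UNIV (limit_map \<rho> X t)"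
proof -
  have "\<rho> t \<in> P1" using assms by (auto simp: P1_curve_def)
  then have "continuous_on UNIV (force G \<rho> t)"
    using norm_force_diff_le[of \<rho> t] L
    by (intro lipschitz_on_continuous_on[of L] lipschitz_onI) (auto simp: dist_norm)
  moreover have X: "continuous_on UNIV (\<lambda>z. X t (fst z))"
    by (rule continuous_on_compose2[OF continuous_on_flow[OF assms]]) (auto intro!: continuous_intros)
  ultimately have "continuous_on UNIV (\<lambda>z. force G \<rho> t (X t (fst z)))"
    by (rule continuous_on_compose2) auto
  with X show ?thesis
    unfolding limit_map_def by (cases "t = 0") (auto intro!: continuous_intros)
qed

text \<open>
  In \<open>position_error\<close>, the two forces differ along \<open>X\<close> by at most \<open>2 * M\<close>, and at each time the difference
  tends to \<open>0\<close>; hence so does its time integral.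
\<close>

lemma position_tendsto:
  assumes curve: "P1_curve {0..<T} \<rho>" and flow: "is_flow {0..<T} (force G \<rho>) X"
    and e: "e \<longlonglongrightarrow> 0"
    and kin: "\<And>n. kinetic_flow (e n) M L T (force G (\<mu> n)) (\<Phi> n)"
    and P1: "\<And>n t. t \<in> {0..<T} \<Longrightarrow> \<mu> n t \<in> P1"
    and lim: "\<And>t. t \<in> {0..<T} \<Longrightarrow> (\<lambda>n. W1 (\<mu> n t) (\<rho> t)) \<longlonglongrightarrow> 0"
    and t: "t \<in> {0..<T}"
  shows "(\<lambda>n. fst (\<Phi> n t z)) \<longlonglongrightarrow> X t (fst z)"
proof -
  define Y where "Y s = X s (fst z)" for s
  define d where "d n s = norm (force G (\<mu> n) s (Y s) - force G \<rho> s (Y s))" for n s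
  have \<rho>: "\<rho> s \<in> P1" if "s \<in> {0..<T}" for s
    using curve that by (auto simp: P1_curve_def)
  have Y': "(Y has_vector_derivative force G \<rho> s (Y s)) (at s within {0..t})" if "s \<in> {0..t}" for s
    unfolding Y_def using that t
    by (intro has_vector_derivative_within_subset[OF is_flow_D(2)[OF flow]]) auto
  have F: "continuous_on ({0..t} \<times> UNIV) (\<lambda>(s, x). force G \<rho> s x)"
    by (rule continuous_on_subset[OF continuous_on_force[OF curve]]) (use t in auto)
  have pair: "continuous_on {0..t} (\<lambda>s. (s, Y s))"
    using Y' by (intro continuous_intros) (rule continuous_on_vector_derivative)
  have intd: "d n integrable_on {0..t}" for n
  proof -
    have "continuous_on {0..t} (\<lambda>s. force G (\<mu> n) s (Y s))"
      using continuous_on_compose2[OF kinetic_flow.E_continuous[OF kin[of n]] pair] t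
      by (simp add: image_subset_iff)
    moreover have "continuous_on {0..t} (\<lambda>s. force G \<rho> s (Y s))"
      using continuous_on_compose2[OF F pair] by (simp add: image_subset_iff)
    ultimately show ?thesis
      unfolding d_def by (intro integrable_continuous_real continuous_intros)
  qed
  have "(\<lambda>n. integral {0..t} (d n)) \<longlonglongrightarrow> integral {0..t} (\<lambda>_. 0)"
  proof (rule dominated_convergence(2)[OF intd])
    show "norm (d n s) \<le> 2 * M" if "s \<in> {0..t}" for n s
    proof -
      have s: "s \<in> {0..<T}" using that t by auto
      show ?thesis
        unfolding d_def
        using norm_triangle_ineq4[of "force G (\<mu> n) s (Y s)" "force G \<rho> s (Y s)"]
          norm_force_le[of "\<mu> n" s "Y s", OF P1[OF s]] norm_force_le[of \<rho> s "Y s", OF \<rho>[OF s]] by simp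
    qed
    show "(\<lambda>n. d n s) \<longlonglongrightarrow> 0" if "s \<in> {0..t}" for s
    proof -
      have s: "s \<in> {0..<T}" using that t by auto
      have "(\<lambda>n. force G (\<mu> n) s (Y s)) \<longlonglongrightarrow> force G \<rho> s (Y s)"
        unfolding force_def using P1[OF s] \<rho>[OF s] lim[OF s]
        by (intro tendsto_minus convol_tendsto) auto
      then show ?thesis
        unfolding d_def by (simp add: LIM_zero tendsto_norm_zero)
    qed
  qed auto
  then have int0: "(\<lambda>n. integral {0..t} (d n)) \<longlonglongrightarrow> 0" by simp
  have "(\<lambda>n. e n * (norm (snd z) + M) + (e n * norm (snd z) + (L * e n * (norm (snd z) + M) * t +
      integral {0..t} (d n))) * exp (L * t)) \<longlonglongrightarrow>
      0 * (norm (snd z) + M) + (0 * norm (snd z) + (L * 0 * (norm (snd z) + M) * t + 0)) * exp (L * t)"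
    by (intro tendsto_intros e int0)
  then have rhs: "(\<lambda>n. e n * (norm (snd z) + M) + (e n * norm (snd z) + (L * e n * (norm (snd z) + M) * t +
      integral {0..t} (d n))) * exp (L * t)) \<longlonglongrightarrow> 0" by simp
  have "norm (fst (\<Phi> n t z) - Y t) \<le> e n * (norm (snd z) + M) +
      (e n * norm (snd z) + (L * e n * (norm (snd z) + M) * t + integral {0..t} (d n))) * exp (L * t)" for n
    unfolding d_def
  proof (rule kinetic_flow.position_error[OF kin _ F _ Y'])
    show "Y 0 = fst z" by (simp add: Y_def is_flow_D(1)[OF flow])
  qed (use t in auto)
  then have "(\<lambda>n. fst (\<Phi> n t z) - Y t) \<longlonglongrightarrow> 0"
    by (intro Lim_null_comparison[OF _ rhs] always_eventually allI)
  then show ?thesis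
    unfolding Y_def by (rule LIM_zero_cancel)
qed

text \<open>
  The velocity is close to the present force \<open>E\<^sub>n(t, x\<^sub>n)\<close>, which in turn is close to \<open>E\<^sub>n(t, x)\<close> by the common Lipschitz
  constant and then to the limiting force at \<open>x\<close>.
\<close>

lemma velocity_tendsto:
  assumes curve: "P1_curve {0..<T} \<rho>"
    and e: "e \<longlonglongrightarrow> 0" and f0: "f0 \<in> P1"
    and kin: "\<And>n. kinetic_flow (e n) M L T (force G (\<lambda>t. first_marginal (f n t))) (\<Phi> n)"
    and f: "\<And>n t. t \<in> {0..T} \<Longrightarrow> f n t = distr f0 borel (\<Phi> n t)"
    and P1: "\<And>n t. t \<in> {0..<T} \<Longrightarrow> f n t \<in> P1"
    and lim: "\<And>t. t \<in> {0..<T} \<Longrightarrow> (\<lambda>n. W1 (first_marginal (f n t)) (\<rho> t)) \<longlonglongrightarrow> 0"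
    and t: "t \<in> {0<..<T}"
    and pos: "(\<lambda>n. fst (\<Phi> n t z)) \<longlonglongrightarrow> x"
  shows "(\<lambda>n. snd (\<Phi> n t z)) \<longlonglongrightarrow> force G \<rho> t x"
proof -
  define E where "E n = force G (\<lambda>t. first_marginal (f n t))" for n
  define B where "B = norm (snd z) + M"
  define C where "C = L * B + L * ((LINT z|f0. norm z) + M)"
  have e_pos: "0 < e n" for n
    using kinetic_flow.eps[OF kin] .
  have tT: "t \<in> {0..T}" "t \<in> {0..<T}" using t by auto
  have m: "0 \<le> (LINT z|f0. norm z)" by simp
  have C0: "0 \<le> C" using L M m by (simp add: C_def B_def)
  have EL: "norm (E n s x - E n s y) \<le> L * norm (x - y)" if "s \<in> {0..T}" for n s x y
    unfolding E_def by (rule kinetic_flow.E_lipschitz[OF kin that])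
  have "norm (snd (\<Phi> n t z) - E n t (fst (\<Phi> n t z))) \<le> (B / t + C) * e n" for n
  proof -
    have "norm (snd (\<Phi> n t z) - E n t (fst (\<Phi> n t z))) \<le> exp (- (t / e n)) * B + C * e n"
      unfolding E_def B_def
    proof (rule kinetic_flow.velocity_relaxation[OF kin tT(1) C0], fold E_def)
      fix s assume s: "s \<in> {0..t}"
      then have sT: "s \<in> {0..T}" using tT by auto
      have "norm (E n s (fst (\<Phi> n s z)) - E n s (fst (\<Phi> n t z))) \<le> L * norm (fst (\<Phi> n t z) - fst (\<Phi> n s z))"
        using EL[OF sT, of n "fst (\<Phi> n s z)" "fst (\<Phi> n t z)"] by (simp add: norm_minus_commute)
      also have "\<dots> \<le> L * (B * (t - s))"
        unfolding B_def using s tT L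
        by (intro mult_left_mono kinetic_flow.position_lipschitz_in_time[OF kin]) auto
      finally have "norm (E n s (fst (\<Phi> n s z)) - E n s (fst (\<Phi> n t z))) \<le> L * (B * (t - s))" .
      moreover have "norm (E n s (fst (\<Phi> n t z)) - E n t (fst (\<Phi> n t z)))
          \<le> L * ((LINT z|f0. norm z) + M) * (t - s)"
        unfolding E_def using s tT
        by (intro force_lipschitz_in_time[OF f0 kin f]) auto
      ultimately show "norm (E n s (fst (\<Phi> n s z)) - E n t (fst (\<Phi> n t z))) \<le> C * (t - s)"
        using norm_triangle_ineq[of "E n s (fst (\<Phi> n s z)) - E n s (fst (\<Phi> n t z))"
            "E n s (fst (\<Phi> n t z)) - E n t (fst (\<Phi> n t z))"]
        by (simp add: C_def algebra_simps)
    qed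
    moreover have "exp (- (t / e n)) * B \<le> e n / t * B"
    proof (rule mult_right_mono)
      have "t / e n \<le> exp (t / e n)"
        using exp_ge_add_one_self[of "t / e n"] by linarith
      then show "exp (- (t / e n)) \<le> e n / t"
        using t e_pos[of n] by (simp add: exp_minus field_simps)
      show "0 \<le> B" using M by (simp add: B_def)
    qed
    moreover have "(B / t + C) * e n = e n / t * B + C * e n"
      by (simp add: distrib_right mult.commute[of B])
    ultimately show ?thesis by linarith
  qed
  moreover have "(\<lambda>n. (B / t + C) * e n) \<longlonglongrightarrow> 0"
    using tendsto_mult_right_zero[OF e] by simp
  ultimately have "(\<lambda>n. snd (\<Phi> n t z) - E n t (fst (\<Phi> n t z))) \<longlonglongrightarrow> 0"
    by (rule Lim_null_comparison[OF always_eventually[OF allI]])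
  moreover have "(\<lambda>n. E n t (fst (\<Phi> n t z)) - E n t x) \<longlonglongrightarrow> 0"
  proof (rule Lim_null_comparison)
    show "\<forall>\<^sub>F n in sequentially. norm (E n t (fst (\<Phi> n t z)) - E n t x) \<le> L * norm (fst (\<Phi> n t z) - x)"
      using EL[OF tT(1)] by simp
    show "(\<lambda>n. L * norm (fst (\<Phi> n t z) - x)) \<longlonglongrightarrow> 0"
      using pos by (intro tendsto_mult_right_zero tendsto_norm_zero LIM_zero)
  qed
  moreover have "(\<lambda>n. E n t x) \<longlonglongrightarrow> force G \<rho> t x"
    unfolding E_def force_def using P1[OF tT(2)] lim[OF tT(2)] curve tT
    by (intro tendsto_minus convol_tendsto) (auto simp: P1_curve_def intro!: always_eventually P1_first_marginal)
  ultimately have "(\<lambda>n. (snd (\<Phi> n t z) - E n t (fst (\<Phi> n t z))) +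
      ((E n t (fst (\<Phi> n t z)) - E n t x) + E n t x)) \<longlonglongrightarrow> 0 + (0 + force G \<rho> t x)"
    by (intro tendsto_add)
  then show ?thesis by simp
qed

text \<open>
  Both limits are taken along sequences, as dominated convergence requires. The domination is linear in
  the initial point \<open>z\<close>: positions and velocities stay within a distance of order \<open>1 + norm z\<close> of their limits,
  uniformly in \<open>\<epsilon>\<close>.
\<close>

lemma small_inertia_limit:
  assumes T: "0 < T" and f0: "f0 \<in> P1"
    and sol: "\<And>\<epsilon>. \<epsilon> > 0 \<Longrightarrow> kinetic_solution G \<epsilon> f0 (feps \<epsilon>)"
    and curve: "P1_curve {0..<T} \<rho>"
    and lim: "\<And>t. t \<in> {0..<T} \<Longrightarrow>
           ((\<lambda>\<epsilon>. W1 (first_marginal (feps \<epsilon> t)) (\<rho> t)) \<longlongrightarrow> 0) (at_right 0)"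
    and flow: "is_flow {0..<T} (force G \<rho>) X" and t: "t \<in> {0..<T}"
  shows "((\<lambda>\<epsilon>. W1 (feps \<epsilon> t) (distr f0 borel (limit_map \<rho> X t))) \<longlongrightarrow> 0) (at_right 0)"
    and "((\<lambda>\<epsilon>. W1 (first_marginal (feps \<epsilon> t)) (distr f0 borel (\<lambda>z. X t (fst z)))) \<longlongrightarrow> 0) (at_right 0)"
proof -
  have both: "(\<lambda>n. W1 (feps (e n) t) (distr f0 borel (limit_map \<rho> X t))) \<longlonglongrightarrow> 0 \<and>
    (\<lambda>n. W1 (first_marginal (feps (e n) t)) (distr f0 borel (\<lambda>z. X t (fst z)))) \<longlonglongrightarrow> 0"
    if e: "\<And>n. e n > 0" "e \<longlonglongrightarrow> 0" for e :: "nat \<Rightarrow> real"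
  proof -
    have "\<exists>\<Phi>. kinetic_flow (e n) M L T (force G (\<lambda>t. first_marginal (feps (e n) t))) \<Phi> \<and>
        (\<forall>t\<in>{0..T}. feps (e n) t = distr f0 borel (\<Phi> t))" for n
      using kinetic_solution_flow[OF sol[OF e(1)] e(1) T] by metis
    then obtain \<Phi> where kin: "\<And>n. kinetic_flow (e n) M L T (force G (\<lambda>t. first_marginal (feps (e n) t))) (\<Phi> n)"
      and f: "\<And>n t. t \<in> {0..T} \<Longrightarrow> feps (e n) t = distr f0 borel (\<Phi> n t)"
      by metis
    have e0: "filterlim e (at_right 0) sequentially"
      using e by (intro tendsto_imp_filterlim_at_right) auto
    have P1: "feps (e n) s \<in> P1" if "s \<in> {0..<T}" for n s
      using sol[OF e(1)[of n]] that unfolding kinetic_solution_def P1_curve_def by auto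
    have limn: "(\<lambda>n. W1 (first_marginal (feps (e n) s)) (\<rho> s)) \<longlonglongrightarrow> 0" if "s \<in> {0..<T}" for s
      using filterlim_compose[OF lim[OF that] e0] .
    have tT: "t \<in> {0..T}" using t by auto
    have pos: "(\<lambda>n. fst (\<Phi> n t z)) \<longlonglongrightarrow> X t (fst z)" for z
      using P1_first_marginal[OF P1] limn t
      by (intro position_tendsto[OF curve flow e(2) kin]) auto
    have vel: "(\<lambda>n. snd (\<Phi> n t z)) \<longlonglongrightarrow> snd (limit_map \<rho> X t z)" for z
    proof (cases "t = 0")
      case True
      then show ?thesis by (simp add: limit_map_def kinetic_flow.flow_0[OF kin])
    next
      case False
      then have "(\<lambda>n. snd (\<Phi> n t z)) \<longlonglongrightarrow> force G \<rho> t (X t (fst z))"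
        using t by (intro velocity_tendsto[OF curve e(2) f0 kin f P1 limn _ pos]) auto
      then show ?thesis using False by (simp add: limit_map_def)
    qed
    have bpos: "norm (fst (\<Phi> n t z) - X t (fst z)) \<le> 2 * M * T + T * norm z" for n z
    proof -
      have "norm (fst (\<Phi> n t z) - fst z) \<le> (norm (snd z) + M) * t"
        using kinetic_flow.position_lipschitz_in_time[OF kin, of 0 t n z] t
        by (simp add: kinetic_flow.flow_0[OF kin])
      moreover have "norm (X t (fst z) - fst z) \<le> M * t"
        by (rule flow_displacement[OF curve flow t])
      ultimately have "norm (fst (\<Phi> n t z) - X t (fst z)) \<le> (norm (snd z) + M) * t + M * t"
        using norm_triangle_ineq4[of "fst (\<Phi> n t z) - fst z" "X t (fst z) - fst z"] by simp
      also have "\<dots> \<le> (norm z + M) * T + M * T"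
        using t M norm_snd_le[of "snd z" "fst z"] by (intro add_mono mult_mono) auto
      finally show ?thesis by (simp add: algebra_simps)
    qed
    have bvel: "norm (snd (\<Phi> n t z) - snd (limit_map \<rho> X t z)) \<le> 2 * M + 2 * norm z" for n z
    proof -
      have "\<rho> t \<in> P1" using curve t by (auto simp: P1_curve_def)
      then have "norm (snd (limit_map \<rho> X t z)) \<le> norm (snd z) + M"
        using norm_force_le[of \<rho> t "X t (fst z)"] M
        by (auto simp: limit_map_def intro: add_increasing)
      then show ?thesis
        using kinetic_flow.velocity_bound[OF kin tT, of n z] norm_snd_le[of "snd z" "fst z"]
          norm_triangle_ineq4[of "snd (\<Phi> n t z)" "snd (limit_map \<rho> X t z)"] by simp
    qed
    have "(\<lambda>n. W1 (distr f0 borel (\<Phi> n t)) (distr f0 borel (limit_map \<rho> X t))) \<longlonglongrightarrow> 0"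
    proof (rule W1_distr_tendsto[OF f0])
      show "(\<lambda>n. \<Phi> n t z) \<longlonglongrightarrow> limit_map \<rho> X t z" for z
        using tendsto_Pair[OF pos vel, of z z] by (simp add: limit_map_def)
      show "dist (\<Phi> n t z) (limit_map \<rho> X t z) \<le> (2 * M * T + 2 * M) + (T + 2) * norm z" for n z
      proof -
        have "dist (\<Phi> n t z) (limit_map \<rho> X t z) =
            norm (fst (\<Phi> n t z) - X t (fst z), snd (\<Phi> n t z) - snd (limit_map \<rho> X t z))"
          by (simp add: dist_norm limit_map_def minus_prod_def)
        also have "\<dots> \<le> norm (fst (\<Phi> n t z) - X t (fst z)) + norm (snd (\<Phi> n t z) - snd (limit_map \<rho> X t z))"
          by (rule norm_Pair_le)
        finally show ?thesis
          using bpos[of n z] bvel[of n z] by (simp add: algebra_simps)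
      qed
    qed (use kinetic_flow.flow_continuous[OF kin tT] continuous_on_limit_map[OF curve flow t] in auto)
    moreover have "(\<lambda>n. W1 (distr f0 borel (\<lambda>z. fst (\<Phi> n t z))) (distr f0 borel (\<lambda>z. X t (fst z)))) \<longlonglongrightarrow> 0"
    proof (rule W1_distr_tendsto[OF f0])
      show "continuous_on UNIV (\<lambda>z. fst (\<Phi> n t z))" for n
        using kinetic_flow.flow_continuous[OF kin tT] by (rule continuous_on_fst)
      show "continuous_on UNIV (\<lambda>z. X t (fst z))"
        by (rule continuous_on_compose2[OF continuous_on_flow[OF curve flow t]]) (auto intro!: continuous_intros)
      show "dist (fst (\<Phi> n t z)) (X t (fst z)) \<le> 2 * M * T + T * norm z" for n z
        using bpos by (simp add: dist_norm)
    qed (rule pos)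
    ultimately show ?thesis
      using f[OF tT] first_marginal_distr[OF f0 kinetic_flow.flow_continuous[OF kin tT]] by simp
  qed
  show "((\<lambda>\<epsilon>. W1 (feps \<epsilon> t) (distr f0 borel (limit_map \<rho> X t))) \<longlongrightarrow> 0) (at_right 0)"
    using both unfolding tendsto_at_iff_sequentially comp_def by auto
  show "((\<lambda>\<epsilon>. W1 (first_marginal (feps \<epsilon> t)) (distr f0 borel (\<lambda>z. X t (fst z)))) \<longlongrightarrow> 0) (at_right 0)"
    using both unfolding tendsto_at_iff_sequentially comp_def by auto
qed

text \<open>
  Along the given family the first marginals converge to \<open>\<rho> t\<close> by hypothesis and to the push-forward by
  \<open>small_inertia_limit\<close>.
\<close>

lemma density_eq_pushforward:
  assumes T: "0 < T" and f0: "f0 \<in> P1"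
    and sol: "\<And>\<epsilon>. \<epsilon> > 0 \<Longrightarrow> kinetic_solution G \<epsilon> f0 (feps \<epsilon>)"
    and curve: "P1_curve {0..<T} \<rho>"
    and lim: "\<And>t. t \<in> {0..<T} \<Longrightarrow>
           ((\<lambda>\<epsilon>. W1 (first_marginal (feps \<epsilon> t)) (\<rho> t)) \<longlongrightarrow> 0) (at_right 0)"
    and flow: "is_flow {0..<T} (force G \<rho>) X" and t: "t \<in> {0..<T}"
  shows "\<rho> t = distr f0 borel (\<lambda>z. X t (fst z))"
proof (rule W1_limit_unique)
  show "\<forall>\<^sub>F \<epsilon> in at_right 0. first_marginal (feps \<epsilon> t) \<in> P1"
    using eventually_at_right_less[of 0]
  proof eventually_elim
    case (elim \<epsilon>)
    then show ?case
      using sol[OF elim] t by (auto simp: kinetic_solution_def P1_curve_def intro!: P1_first_marginal)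
  qed
  show "\<rho> t \<in> P1" using curve t by (auto simp: P1_curve_def)
  show "distr f0 borel (\<lambda>z. X t (fst z)) \<in> P1"
  proof (rule P1_distr[OF f0])
    show "continuous_on UNIV (\<lambda>z. X t (fst z))"
      by (rule continuous_on_compose2[OF continuous_on_flow[OF curve flow t]]) (auto intro!: continuous_intros)
    show "norm (X t (fst z)) \<le> M * t + 1 * norm z" for z
      using flow_displacement[OF curve flow t, of "fst z"] norm_fst_le[of "fst z" "snd z"]
        norm_triangle_sub[of "X t (fst z)" "fst z"] by simp
  qed
  show "((\<lambda>\<epsilon>. W1 (first_marginal (feps \<epsilon> t)) (distr f0 borel (\<lambda>z. X t (fst z)))) \<longlongrightarrow> 0) (at_right 0)"
    by (rule small_inertia_limit(2)[OF T f0 sol curve lim flow t])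
qed (use lim[OF t] in auto)

lemma limit_map_P1:
  assumes f0: "f0 \<in> P1" and curve: "P1_curve {0..<T} \<rho>"
    and flow: "is_flow {0..<T} (force G \<rho>) X" and t: "t \<in> {0..<T}"
  shows "distr f0 borel (limit_map \<rho> X t) \<in> P1"
proof (rule P1_distr[OF f0 continuous_on_limit_map[OF curve flow t]])
  fix z :: "'a \<times> 'a"
  have "\<rho> t \<in> P1" using curve t by (auto simp: P1_curve_def)
  then have "norm (snd (limit_map \<rho> X t z)) \<le> norm (snd z) + M"
    using norm_force_le[of \<rho> t "X t (fst z)"] M
    by (auto simp: limit_map_def intro: add_increasing)
  moreover have "norm (X t (fst z)) \<le> M * t + norm (fst z)"
    using flow_displacement[OF curve flow t, of "fst z"] norm_triangle_sub[of "X t (fst z)" "fst z"] by simp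
  moreover have "norm (limit_map \<rho> X t z) \<le> norm (X t (fst z)) + norm (snd (limit_map \<rho> X t z))"
    unfolding limit_map_def snd_conv by (rule norm_Pair_le)
  ultimately show "norm (limit_map \<rho> X t z) \<le> (M * t + M) + 2 * norm z"
    using norm_fst_le[of "fst z" "snd z"] norm_snd_le[of "snd z" "fst z"] by simp
qed

lemma limit_monokinetic:
  assumes f0: "f0 \<in> P1" and curve: "P1_curve {0..<T} \<rho>"
    and flow: "is_flow {0..<T} (force G \<rho>) X" and t: "t \<in> {0<..<T}"
    and \<rho>: "\<rho> t = distr f0 borel (\<lambda>z. X t (fst z))"
  shows "monokinetic (\<rho> t) (\<lambda>x. - convol G (\<rho> t) x) (distr f0 borel (limit_map \<rho> X t))"
  unfolding monokinetic_def
proof (intro allI impI)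
  fix \<zeta> :: "'a \<times> 'a \<Rightarrow> real" assume \<zeta>: "continuous_on UNIV \<zeta>"
  have t': "t \<in> {0..<T}" using t by auto
  have "\<rho> t \<in> P1" using curve t' by (auto simp: P1_curve_def)
  then have u: "continuous_on UNIV (force G \<rho> t)"
    using norm_force_diff_le[of \<rho> t] L
    by (intro lipschitz_on_continuous_on[of L] lipschitz_onI) (auto simp: dist_norm)
  have [measurable_cong]: "sets f0 = sets borel" using P1_D(2)[OF f0] .
  have X: "continuous_on UNIV (\<lambda>z. X t (fst z))"
    by (rule continuous_on_compose2[OF continuous_on_flow[OF curve flow t']]) (auto intro!: continuous_intros)
  have [measurable]: "limit_map \<rho> X t \<in> borel_measurable borel" "\<zeta> \<in> borel_measurable borel"
      "(\<lambda>z. X t (fst z)) \<in> borel_measurable borel"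
    using continuous_on_limit_map[OF curve flow t'] \<zeta> X by (auto intro: borel_measurable_continuous_onI)
  have [measurable]: "(\<lambda>x. \<zeta> (x, force G \<rho> t x)) \<in> borel_measurable borel"
    by (intro borel_measurable_continuous_onI continuous_on_compose2[OF \<zeta>] continuous_intros u) auto
  have "(LINT z|distr f0 borel (limit_map \<rho> X t). \<zeta> z) = (LINT z|f0. \<zeta> (limit_map \<rho> X t z))"
    by (rule integral_distr) measurable
  also have "\<dots> = (LINT z|f0. \<zeta> (X t (fst z), force G \<rho> t (X t (fst z))))"
    using t by (simp add: limit_map_def)
  also have "\<dots> = (LINT x|distr f0 borel (\<lambda>z. X t (fst z)). \<zeta> (x, force G \<rho> t x))"
    by (rule integral_distr[symmetric]) measurable
  finally show "(LINT z|distr f0 borel (limit_map \<rho> X t). \<zeta> z) = (LINT x|\<rho> t. \<zeta> (x, - convol G (\<rho> t) x))"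
    unfolding \<rho>[symmetric] force_def .
qed

end

theorem theorem5p3:
  fixes T :: real
    and K :: "'a::euclidean_space \<Rightarrow> real"
    and gK :: "'a \<Rightarrow> 'a"
    and f0 :: "('a \<times> 'a) measure"
    and feps :: "real \<Rightarrow> real \<Rightarrow> ('a \<times> 'a) measure"
    and \<rho> :: "real \<Rightarrow> 'a measure"
  assumes "T > 0"
    and "radial K"
    and "potential_gradient K gK"
    and "f0 \<in> P1"
    and "compact (msupport f0)"
    and "\<And>\<epsilon>. \<epsilon> > 0 \<Longrightarrow> kinetic_solution gK \<epsilon> f0 (feps \<epsilon>)"
    and "P1_curve {0..<T} \<rho>"
    and "\<And>t. t \<in> {0..<T} \<Longrightarrow>
           ((\<lambda>\<epsilon>. W1 (first_marginal (feps \<epsilon> t)) (\<rho> t)) \<longlongrightarrow> 0) (at_right 0)"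
  shows "(\<exists>X. is_flow {0..<T} (force gK \<rho>) X) \<and>
    (\<forall>X. is_flow {0..<T} (force gK \<rho>) X \<longrightarrow>
       (\<forall>t\<in>{0..<T}. \<rho> t = distr (first_marginal f0) borel (X t))) \<and>
    (\<exists>f. (\<forall>t\<in>{0..<T}. f t \<in> P1 \<and>
            ((\<lambda>\<epsilon>. W1 (feps \<epsilon> t) (f t)) \<longlongrightarrow> 0) (at_right 0) \<and>
            first_marginal (f t) = \<rho> t) \<and>
         (\<forall>t\<in>{0<..<T}. monokinetic (\<rho> t) (\<lambda>x. - convol gK (\<rho> t) x) (f t)))"
proof -
  obtain M L where "0 < M" "0 < L" "\<And>x. norm (gK x) \<le> M"
    "\<And>x y. norm (gK x - gK y) \<le> L * norm (x - y)"
    using potential_gradient_bounded_lipschitz[OF assms(3)] by blast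
  then interpret bounded_lipschitz_kernel gK M L
    by unfold_locales
  note T = assms(1) and f0 = assms(4) and sol = assms(6) and curve = assms(7) and lim = assms(8)
  have \<rho>: "\<rho> t \<in> P1" if "t \<in> {0..<T}" for t
    using curve that by (auto simp: P1_curve_def)
  have ex: "\<exists>X. is_flow {0..<T} (force gK \<rho>) X"
    using norm_force_le[of \<rho>, OF \<rho>] norm_force_diff_le[of \<rho>, OF \<rho>]
    by (intro picard_lindelof[OF T \<open>0 < L\<close> continuous_on_force[OF curve]])
  have push: "\<rho> t = distr f0 borel (\<lambda>z. X t (fst z))"
    if "is_flow {0..<T} (force gK \<rho>) X" "t \<in> {0..<T}" for X t
    by (rule density_eq_pushforward[OF T f0 sol curve lim that])
  have "\<rho> t = distr (first_marginal f0) borel (X t)"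
    if X: "is_flow {0..<T} (force gK \<rho>) X" and t: "t \<in> {0..<T}" for X t
  proof -
    have "X t \<in> borel_measurable borel"
      using continuous_on_flow[OF curve X t] by (rule borel_measurable_continuous_onI)
    moreover have "fst \<in> measurable f0 borel"
      using P1_D(2)[OF f0] by (simp add: borel_measurable_fst_snd cong: measurable_cong_sets)
    ultimately show ?thesis
      unfolding push[OF X t] first_marginal_def by (simp add: distr_distr comp_def)
  qed
  then have all: "\<forall>X. is_flow {0..<T} (force gK \<rho>) X \<longrightarrow>
       (\<forall>t\<in>{0..<T}. \<rho> t = distr (first_marginal f0) borel (X t))"
    by blast
  obtain X where X: "is_flow {0..<T} (force gK \<rho>) X" using ex by blast
  have "first_marginal (distr f0 borel (limit_map \<rho> X t)) = \<rho> t" if "t \<in> {0..<T}" for t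
    unfolding first_marginal_distr[OF f0 continuous_on_limit_map[OF curve X that]] push[OF X that]
    by (simp add: limit_map_def)
  then have "(\<forall>t\<in>{0..<T}. distr f0 borel (limit_map \<rho> X t) \<in> P1 \<and>
            ((\<lambda>\<epsilon>. W1 (feps \<epsilon> t) (distr f0 borel (limit_map \<rho> X t))) \<longlongrightarrow> 0) (at_right 0) \<and>
            first_marginal (distr f0 borel (limit_map \<rho> X t)) = \<rho> t) \<and>
         (\<forall>t\<in>{0<..<T}. monokinetic (\<rho> t) (\<lambda>x. - convol gK (\<rho> t) x) (distr f0 borel (limit_map \<rho> X t)))"
    using limit_map_P1[OF f0 curve X] small_inertia_limit(1)[OF T f0 sol curve lim X]
      limit_monokinetic[OF f0 curve X] push[OF X] by simp
  with ex all show ?thesis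
    by (intro conjI exI[of _ "\<lambda>t. distr f0 borel (limit_map \<rho> X t)"]) auto
qed

end
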